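(* Let $\xi=\delta Z$ with $Z\sim\mathcal N(0,I_D)$ and $\delta\in(0,1)$. Without any assumption on the singular values $(\lambda_i)$ and for any signal $f\in\mathbb{R}^P$ and any critical value $\kappa>0$, the prediction error at the stopping rule $\tau=\inf\{t\in[0,d]: R_t^2\le\kappa\}$ satisfies $$\mathbb{E}\big[\|A(\widehat f_\tau-f)\|^2\big]\le C\big(\mathbb{E}[S_{\tau_{\mathfrak b},\lambda}]+\delta^2\sqrt D+|\kappa-\delta^2D|\big)$$ with a numerical constant $C>0$.
   Context: Model: $D\ge 3$ and $P\ge D$ are integers, $A\in\mathbb{R}^{D\times P}$ has rank $D$, $f\in\mathbb{R}^P$, $g=Af$, $\xi\in\mathbb{R}^D$ is an error vector, and $Y=g+\xi$ is observed. $\|\cdot\|$ is the Euclidean norm, $A^\dagger=A^\top(AA^\top)^{-1}$. Let $\lambda_1\ge\dots\ge\lambda_D>0$ be the nonzero singular values of $A$ (with multiplicity), $u_i$, $v_i$ the left and right singular vectors, $\tilde\lambda_1>\dots>\tilde\lambda_d>0$ the distinct singular values. Put $Y_i=\langle Y,u_i\rangle$. For a function $h$ on $[0,\infty)$ and $w\in\mathbb{R}^D$, $h(AA^\top)w=\sum_{i=1}^D h(\lambda_i^2)\langle w,u_i\rangle u_i$. Standing assumption: $\sum_{j:\lambda_j=\lambda_i}Y_j^2>0$ for all $i=1,\dots,D$ (this holds almost surely under Gaussian noise). Interpolated conjugate gradients: for $k=0,\dots,d$, $r_k$ is the unique minimiser of $\|p(AA^\top)Y\|^2$ over real polynomials $p$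 of degree at most $k$ with $p(0)=1$. For $t=k+\alpha$, $k\in\{0,\dots,d-1\}$, $\alpha\in(0,1]$, $r_t=(1-\alpha)r_k+\alpha r_{k+1}$. For $t\in[0,d]$: $\widehat f_t=A^\dagger(I_D-r_t(AA^\top))Y$ and $R_t^2=\|A\widehat f_t-Y\|^2=\|r_t(AA^\top)Y\|^2$. For $t\in(0,d]$, $x_{1,t}$ is the smallest zero of $r_t$ on $[0,\infty)$ and $r_{t,<}(x)=r_t(x)\mathbf 1(x<x_{1,t})$; $r_{0,<}\equiv1$. Error terms: $S_{t,\lambda}=\|(1-r_{t,<})^{1/2}(AA^\top)\xi\|^2$ and $A_{t,\lambda}=\|r_{t,<}^{1/2}(AA^\top)g\|^2+R_t^2-\|r_{t,<}^{1/2}(AA^\top)Y\|^2$. Balanced oracle: $\tau_{\mathfrak b}=\inf\{t\in[0,d]: A_{t,\lambda}\le S_{t,\lambda}\}$. *)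

theory Defs
  imports
    "HOL-Probability.Distributions"
    "HOL-Computational_Algebra.Polynomial"
    "Jordan_Normal_Form.Gauss_Jordan_Elimination"
    "Jordan_Normal_Form.DL_Rank"
begin

unbundle no vec_syntax
unbundle no inner_syntax

hide_const (open) Finite_Cartesian_Product.vec
hide_type (open) Finite_Cartesian_Product.vec

text \<open>
  Vectors and matrices are those of \<^theory>\<open>Jordan_Normal_Form.Matrix\<close>: the dimensions are
  natural numbers rather than types, so that a constant can be asserted to exist uniformly in
  the dimensions. Indices start at 0; thus \<open>sv i\<close>, \<open>u i\<close>, \<open>v i\<close> for \<open>i < D\<close> are the singular
  values and the left and right singular vectors usually numbered \<open>i + 1\<close>.
\<close>

definition euclid_norm :: "real vec \<Rightarrow> real" where
  "euclid_norm w = sqrt (w \<bullet> w)"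

definition orthonormal_family :: "nat \<Rightarrow> (nat \<Rightarrow> real vec) \<Rightarrow> bool" where
  "orthonormal_family m w \<longleftrightarrow> (\<forall>i<m. \<forall>j<m. w i \<bullet> w j = (if i = j then 1 else 0))"

text \<open>
  A singular system of a matrix with \<open>D\<close> rows, \<open>P\<close> columns and rank \<open>D\<close>: the positive singular
  values in non-increasing order, repeated according to multiplicity, with singular vectors.
\<close>

definition singular_system ::
    "nat \<Rightarrow> nat \<Rightarrow> real mat \<Rightarrow> (nat \<Rightarrow> real) \<Rightarrow> (nat \<Rightarrow> real vec) \<Rightarrow> (nat \<Rightarrow> real vec) \<Rightarrow> bool" where
  "singular_system D P A sv u v \<longleftrightarrow>
     (\<forall>i j. i \<le> j \<and> j < D \<longrightarrow> sv j \<le> sv i) \<and>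
     (\<forall>i<D. 0 < sv i) \<and>
     (\<forall>i<D. u i \<in> carrier_vec D) \<and> (\<forall>i<D. v i \<in> carrier_vec P) \<and>
     orthonormal_family D u \<and> orthonormal_family D v \<and>
     (\<forall>i<D. A *\<^sub>v v i = sv i \<cdot>\<^sub>v u i \<and> transpose_mat A *\<^sub>v u i = sv i \<cdot>\<^sub>v v i)"

definition num_distinct_sv :: "nat \<Rightarrow> (nat \<Rightarrow> real) \<Rightarrow> nat" where
  "num_distinct_sv D sv = card (sv ` {..<D})"

text \<open>The pseudo-inverse of a matrix of full row rank.\<close>

definition pinv :: "real mat \<Rightarrow> real mat" where
  "pinv A = transpose_mat A * the (mat_inverse (A * transpose_mat A))"

text \<open>\<open>spec_fun D sv u h w\<close> is \<open>h (A A\<^sup>T) w = (\<Sum>i. h (\<lambda>\<^sub>i\<^sup>2) \<langle>w, u\<^sub>i\<rangle> u\<^sub>i)\<close>.\<close>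

definition spec_fun ::
    "nat \<Rightarrow> (nat \<Rightarrow> real) \<Rightarrow> (nat \<Rightarrow> real vec) \<Rightarrow> (real \<Rightarrow> real) \<Rightarrow> real vec \<Rightarrow> real vec" where
  "spec_fun D sv u h w = vec D (\<lambda>l. \<Sum>i<D. h ((sv i)\<^sup>2) * (w \<bullet> u i) * (u i $ l))"

text \<open>
  The residual polynomial after \<open>k\<close> steps. The minimiser is unique for \<open>k \<le> num_distinct_sv D sv\<close>
  whenever \<open>Y\<close> has a nonzero component in every eigenspace of \<open>A A\<^sup>T\<close>, which holds almost
  surely under Gaussian noise; on the exceptional null set the value is unspecified.
\<close>

definition cg_poly ::
    "nat \<Rightarrow> (nat \<Rightarrow> real) \<Rightarrow> (nat \<Rightarrow> real vec) \<Rightarrow> real vec \<Rightarrow> nat \<Rightarrow> real poly" where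
  "cg_poly D sv u Y k =
     (THE p. is_arg_min (\<lambda>q. (euclid_norm (spec_fun D sv u (poly q) Y))\<^sup>2)
               (\<lambda>q. degree q \<le> k \<and> poly q 0 = 1) p)"

text \<open>
  For \<open>t > 0\<close> the unique decomposition \<open>t = k + \<alpha>\<close> with \<open>k\<close> a natural number and
  \<open>\<alpha> \<in> {0<..1}\<close> has \<open>k = \<lceil>t\<rceil> - 1\<close>.
\<close>

definition cg_interp ::
    "nat \<Rightarrow> (nat \<Rightarrow> real) \<Rightarrow> (nat \<Rightarrow> real vec) \<Rightarrow> real vec \<Rightarrow> real \<Rightarrow> real poly" where
  "cg_interp D sv u Y t =
     (if t \<le> 0 then cg_poly D sv u Y 0
      else (let k = nat (\<lceil>t\<rceil> - 1); \<alpha> = t - real k in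
        Polynomial.smult (1 - \<alpha>) (cg_poly D sv u Y k) + Polynomial.smult \<alpha> (cg_poly D sv u Y (Suc k))))"

definition cg_estimator ::
    "nat \<Rightarrow> real mat \<Rightarrow> (nat \<Rightarrow> real) \<Rightarrow> (nat \<Rightarrow> real vec) \<Rightarrow> real vec \<Rightarrow> real \<Rightarrow> real vec" where
  "cg_estimator D A sv u Y t =
     pinv A *\<^sub>v (Y - spec_fun D sv u (poly (cg_interp D sv u Y t)) Y)"

text \<open>The squared residual norm \<open>R\<^sub>t\<^sup>2\<close>.\<close>

definition cg_res ::
    "nat \<Rightarrow> real mat \<Rightarrow> (nat \<Rightarrow> real) \<Rightarrow> (nat \<Rightarrow> real vec) \<Rightarrow> real vec \<Rightarrow> real \<Rightarrow> real" where
  "cg_res D A sv u Y t = (euclid_norm (A *\<^sub>v cg_estimator D A sv u Y t - Y))\<^sup>2"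

definition first_zero :: "real poly \<Rightarrow> real" where
  "first_zero p = (LEAST x. 0 \<le> x \<and> poly p x = 0)"

definition cg_trunc ::
    "nat \<Rightarrow> (nat \<Rightarrow> real) \<Rightarrow> (nat \<Rightarrow> real vec) \<Rightarrow> real vec \<Rightarrow> real \<Rightarrow> real \<Rightarrow> real" where
  "cg_trunc D sv u Y t x =
     (if t \<le> 0 then 1
      else poly (cg_interp D sv u Y t) x *
           of_bool (x < first_zero (cg_interp D sv u Y t)))"

definition stoch_err ::
    "nat \<Rightarrow> (nat \<Rightarrow> real) \<Rightarrow> (nat \<Rightarrow> real vec) \<Rightarrow> real vec \<Rightarrow> real vec \<Rightarrow> real \<Rightarrow> real" where
  "stoch_err D sv u g \<xi> t =
     (euclid_norm (spec_fun D sv u (\<lambda>x. sqrt (1 - cg_trunc D sv u (g + \<xi>) t x)) \<xi>))\<^sup>2"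

definition approx_err ::
    "nat \<Rightarrow> real mat \<Rightarrow> (nat \<Rightarrow> real) \<Rightarrow> (nat \<Rightarrow> real vec) \<Rightarrow> real vec \<Rightarrow> real vec \<Rightarrow> real \<Rightarrow> real" where
  "approx_err D A sv u g \<xi> t =
     (euclid_norm (spec_fun D sv u (\<lambda>x. sqrt (cg_trunc D sv u (g + \<xi>) t x)) g))\<^sup>2
     + cg_res D A sv u (g + \<xi>) t
     - (euclid_norm (spec_fun D sv u (\<lambda>x. sqrt (cg_trunc D sv u (g + \<xi>) t x)) (g + \<xi>)))\<^sup>2"

definition balanced_oracle ::
    "nat \<Rightarrow> real mat \<Rightarrow> (nat \<Rightarrow> real) \<Rightarrow> (nat \<Rightarrow> real vec) \<Rightarrow> real vec \<Rightarrow> real vec \<Rightarrow> real" where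
  "balanced_oracle D A sv u g \<xi> =
     Inf {t \<in> {0..real (num_distinct_sv D sv)}.
            approx_err D A sv u g \<xi> t \<le> stoch_err D sv u g \<xi> t}"

definition stopping_time ::
    "nat \<Rightarrow> real mat \<Rightarrow> (nat \<Rightarrow> real) \<Rightarrow> (nat \<Rightarrow> real vec) \<Rightarrow> real \<Rightarrow> real vec \<Rightarrow> real" where
  "stopping_time D A sv u \<kappa> Y =
     Inf {t \<in> {0..real (num_distinct_sv D sv)}. cg_res D A sv u Y t \<le> \<kappa>}"

text \<open>
  The law \<open>N(0, I\<^sub>D)\<close>. A point \<open>z\<close> of this measure lists the coordinates of a standard Gaussian
  vector, which as an element of \<open>\<real>\<^sup>D\<close> is \<open>vec D z\<close>.
\<close>

definition std_gaussian :: "nat \<Rightarrow> (nat \<Rightarrow> real) measure" where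
  "std_gaussian D = (\<Pi>\<^sub>M i\<in>{..<D}. density lborel (\<lambda>x. ennreal (std_normal_density x)))"

end

theory Submission
  imports Defs
begin

text \<open>
  In the eigenbasis of \<open>A A\<^sup>T\<close> put \<open>\<phi> = r\<^bsub>t,<\<^esub>\<close>, \<open>L\<^sub>t = \<parallel>\<xi> - r\<^sub>t Y\<parallel>\<^sup>2\<close> (the prediction error), and write \<open>S\<close>, \<open>A\<close>
  for the two error terms. Then \<open>S + A - L = 2 \<langle>(r - \<phi>) Y, \<xi>\<rangle>\<close>, and \<open>r \<noteq> \<phi>\<close> only where \<open>\<phi> = 0\<close>, where
  \<open>S\<close> contains the full noise; hence \<open>L \<le> 10 S + 2 A\<close>, so \<open>L \<le> 12 S\<close> and \<open>\<parallel>\<phi> g\<parallel>\<^sup>2 \<le> 26 S\<close> at the balanced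
  oracle. There \<open>R\<^sup>2 - \<parallel>\<xi>\<parallel>\<^sup>2 = A - S + 2 \<langle>\<phi> g, \<xi>\<rangle>\<close>. Since \<open>\<phi>\<close> is random only through a monotone
  weight, the part of the cross term with \<open>\<phi> > 1/2\<close> is at most a multiple of \<open>\<parallel>\<phi> g\<parallel>\<^sup>2\<close> plus the maximum
  of the partial sums of \<open>g\<^sub>i \<xi>\<^sub>i\<close> with drift \<open>- g\<^sub>i\<^sup>2\<close>; this maximum has expectation of order
  \<open>\<delta>\<^sup>2 sqrt D\<close> by an exponential union bound, and the part with \<open>\<phi> \<le> 1/2\<close> is absorbed by \<open>S\<close>. So \<open>R\<^sup>2\<close> at the
  oracle is close to \<open>\<parallel>\<xi>\<parallel>\<^sup>2\<close>, hence to \<open>\<delta>\<^sup>2 D\<close> and to \<open>\<kappa>\<close>, and orthogonality of the residual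
  polynomials gives \<open>\<parallel>(r\<^sub>s - r\<^sub>t) Y\<parallel>\<^sup>2 \<le> \<bar>R\<^sub>s\<^sup>2 - R\<^sub>t\<^sup>2\<bar>\<close>, which compares the stopping rule with the oracle.
\<close>

subsection \<open>Polynomials with positive roots\<close>

text \<open>Induction on the degree, splitting off one positive root at a time. A root met again
  leaves \<open>Z\<close> and its squared factor joins \<open>s\<close>, so \<open>Z\<close> ends up
  as the positive roots of odd multiplicity. Without positive roots the intermediate value theorem
  forbids a sign change. The linear factors are normalised to the value 1 at 0.\<close>

lemma factor_constant_sign:
  fixes p :: "real poly"
  assumes "p \<noteq> 0"
  obtains Z s where "finite Z" "Z \<subseteq> {0<..}" "p = (\<Prod>z\<in>Z. [:1, - (1 / z):]) * s"
    "(\<forall>y>0. 0 \<le> poly s y) \<or> (\<forall>y>0. poly s y \<le> 0)"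
proof -
  have "\<exists>Z s. finite Z \<and> Z \<subseteq> {0<..} \<and> p = (\<Prod>z\<in>Z. [:1, - (1 / z):]) * s \<and>
    ((\<forall>y>0. 0 \<le> poly s y) \<or> (\<forall>y>0. poly s y \<le> 0))"
    using assms
  proof (induction "degree p" arbitrary: p rule: less_induct)
    case less
    show ?case
    proof (cases "\<exists>z>0. poly p z = 0")
      case False
      have "(\<forall>y>0. 0 \<le> poly p y) \<or> (\<forall>y>0. poly p y \<le> 0)"
      proof (rule ccontr)
        assume "\<not> ?thesis"
        then obtain a b where ab: "a > 0" "b > 0" "poly p a < 0" "poly p b > 0"
          by (auto simp: not_le)
        have "a \<noteq> b" using ab by auto
        then consider "a < b" | "b < a" by linarith
        then have "\<exists>y. min a b < y \<and> poly p y = 0"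
        proof cases
          case 1
          then show ?thesis using poly_IVT_pos[of a b p] ab by (auto intro: exI)
        next
          case 2
          then show ?thesis using poly_IVT_neg[of b a p] ab by (auto intro: exI)
        qed
        then show False using False ab by (auto simp: min_less_iff_disj)
      qed
      then show ?thesis by (intro exI[of _ "{}"] exI[of _ p]) simp
    next
      case True
      then obtain z where z: "z > 0" "poly p z = 0" by blast
      then obtain q where q: "p = [:- z, 1:] * q" by (auto simp: poly_eq_0_iff_dvd)
      define q' where "q' = Polynomial.smult (- z) q"
      have "[:- z, 1:] = Polynomial.smult (- z) [:1, - (1 / z):]" using z by simp
      then have p: "p = [:1, - (1 / z):] * q'" unfolding q q'_def by (simp only: mult_smult_left mult_smult_right)
      have "q' \<noteq> 0" using p less.prems by auto
      moreover have "degree q' < degree p"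
        using \<open>q' \<noteq> 0\<close> z p by (subst p, subst degree_mult_eq) auto
      ultimately obtain Z s where Z: "finite Z" "Z \<subseteq> {0<..}"
        "q' = (\<Prod>z\<in>Z. [:1, - (1 / z):]) * s"
        "(\<forall>y>0. 0 \<le> poly s y) \<or> (\<forall>y>0. poly s y \<le> 0)"
        using less.hyps by blast
      show ?thesis
      proof (cases "z \<in> Z")
        case False
        have "p = (\<Prod>z\<in>insert z Z. [:1, - (1 / z):]) * s"
          unfolding p Z(3) prod.insert[OF Z(1) False] by (rule mult.assoc[symmetric])
        then show ?thesis
          using Z z by (intro exI[of _ "insert z Z"] exI[of _ s]) auto
      next
        case True
        have "p = (\<Prod>z\<in>Z - {z}. [:1, - (1 / z):]) * ([:1, - (1 / z):]\<^sup>2 * s)"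
          unfolding p Z(3) prod.remove[OF Z(1) True] power2_eq_square by (simp only: mult_ac)
        moreover have "(\<forall>y>0. 0 \<le> poly ([:1, - (1 / z):]\<^sup>2 * s) y) \<or>
            (\<forall>y>0. poly ([:1, - (1 / z):]\<^sup>2 * s) y \<le> 0)"
          using Z(4) by (auto simp: mult_nonneg_nonpos)
        ultimately show ?thesis
          using Z(1,2) by (intro exI[of _ "Z - {z}"] exI[of _ "[:1, - (1 / z):]\<^sup>2 * s"]) blast
      qed
    qed
  qed
  then show ?thesis using that by blast
qed

lemma degree_prod_linear:
  assumes "finite Z" "Z \<subseteq> {0::real<..}"
  shows "degree (\<Prod>z\<in>Z. [:1, - (1 / z):]) = card Z"
proof -
  have "degree (\<Prod>z\<in>Z. [:1, - (1 / z):]) = (\<Sum>z\<in>Z. degree [:1, - (1 / z):])"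
    using assms by (intro degree_prod_eq_sum_degree) auto
  also have "\<dots> = (\<Sum>z\<in>Z. 1)" using assms by (intro sum.cong) auto
  finally show ?thesis by simp
qed

text \<open>Each factor has a negative leading coefficient, so the sign reveals the parity of the
  number of roots. This detects a missing root of an interpolated residual polynomial.\<close>

lemma lead_coeff_prod_linear_sign:
  assumes "finite Z" "Z \<subseteq> {0::real<..}"
  shows "0 < (- 1) ^ card Z * lead_coeff (\<Prod>z\<in>Z. [:1, - (1 / z):])"
proof -
  have "lead_coeff (\<Prod>z\<in>Z. [:1, - (1 / z):]) = (\<Prod>z\<in>Z. lead_coeff [:1, - (1 / z):])"
    by (rule lead_coeff_prod)
  also have "\<dots> = (\<Prod>z\<in>Z. - 1 * (1 / z))" using assms by (intro prod.cong) auto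
  also have "\<dots> = (- 1) ^ card Z * (\<Prod>z\<in>Z. 1 / z)"
    by (simp only: prod.distrib prod_constant)
  finally have "(- 1) ^ card Z * lead_coeff (\<Prod>z\<in>Z. [:1, - (1 / z):]) = (\<Prod>z\<in>Z. 1 / z)"
    by (cases "even (card Z)") auto
  also have "\<dots> > 0" using assms by (intro prod_pos) auto
  finally show ?thesis .
qed

text \<open>Both sides have degree at most \<open>card Z\<close> and agree on \<open>Z\<close> and
  at 0, hence at \<open>card Z + 1\<close> points.\<close>

lemma prod_linear_unique:
  fixes p :: "real poly"
  assumes "finite Z" "Z \<subseteq> {0<..}" "degree p \<le> card Z" "poly p 0 = 1" "\<And>z. z \<in> Z \<Longrightarrow> poly p z = 0"
  shows "p = (\<Prod>z\<in>Z. [:1, - (1 / z):])"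
proof (rule ccontr)
  define q where "q = p - (\<Prod>z\<in>Z. [:1, - (1 / z):])"
  assume "p \<noteq> (\<Prod>z\<in>Z. [:1, - (1 / z):])"
  then have "q \<noteq> 0" by (simp add: q_def)
  have "degree q \<le> card Z"
    unfolding q_def using assms degree_prod_linear[of Z] by (intro degree_diff_le) auto
  moreover have "insert 0 Z \<subseteq> {y. poly q y = 0}"
    using assms by (auto simp: q_def poly_prod prod_zero_iff)
  then have "card (insert 0 Z) \<le> degree q"
    using card_mono[OF poly_roots_finite[OF \<open>q \<noteq> 0\<close>]] card_poly_roots_bound[OF \<open>q \<noteq> 0\<close>]
    by (meson order_trans)
  moreover have "0 \<notin> Z" using assms by auto
  ultimately show False using assms by simp
qed

text \<open>
  For a polynomial \<open>p\<close> with \<open>p(0) = 1\<close> and only positive roots, cutting off at the first root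
  agrees with this lower envelope, whose continuity in the coefficients of \<open>p\<close> is immediate.
\<close>

definition envelope :: "(real \<Rightarrow> real) \<Rightarrow> real \<Rightarrow> real" where
  "envelope h y = max 0 (INF a\<in>{0..y}. h a)"

lemma bdd_below_cont:
  fixes h :: "real \<Rightarrow> real"
  assumes "continuous_on {0..y} h"
  shows "bdd_below (h ` {0..y})"
  by (intro bounded_imp_bdd_below compact_imp_bounded compact_continuous_image assms) simp

lemma envelope_antimono:
  assumes "continuous_on {0..y'} h" "0 \<le> y" "y \<le> y'"
  shows "envelope h y' \<le> envelope h y"
proof -
  have "(INF a\<in>{0..y'}. h a) \<le> (INF a\<in>{0..y}. h a)"
    using assms bdd_below_cont by (intro cINF_superset_mono) auto
  then show ?thesis by (auto simp: envelope_def)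
qed

lemma envelope_bounds:
  assumes "continuous_on {0..y} h" "0 \<le> y" "h 0 = 1"
  shows "0 \<le> envelope h y" "envelope h y \<le> 1"
proof -
  have "(INF a\<in>{0..y}. h a) \<le> h 0"
    using assms bdd_below_cont by (intro cINF_lower) auto
  then show "envelope h y \<le> 1" using assms by (simp add: envelope_def)
qed (simp add: envelope_def)

text \<open>A uniform perturbation by \<epsilon> moves an infimum by at most \<epsilon>, and
  \<open>max 0\<close> does not expand distances.\<close>

lemma envelope_lipschitz:
  assumes "continuous_on {0..y} h" "continuous_on {0..y} h'" "0 \<le> y"
    "\<And>a. a \<in> {0..y} \<Longrightarrow> \<bar>h a - h' a\<bar> \<le> \<epsilon>"
  shows "\<bar>envelope h y - envelope h' y\<bar> \<le> \<epsilon>"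
proof -
  have *: "(INF a\<in>{0..y}. k a) - \<epsilon> \<le> (INF a\<in>{0..y}. k' a)"
    if "continuous_on {0..y} k" "\<And>a. a \<in> {0..y} \<Longrightarrow> \<bar>k a - k' a\<bar> \<le> \<epsilon>" for k k'
  proof (rule cINF_greatest)
    show "{0..y} \<noteq> {}" using assms by simp
    fix a assume a: "a \<in> {0..y}"
    have "(INF a\<in>{0..y}. k a) \<le> k a"
      using that bdd_below_cont a by (intro cINF_lower) auto
    then show "(INF a\<in>{0..y}. k a) - \<epsilon> \<le> k' a" using that(2)[OF a] by linarith
  qed
  have "(INF a\<in>{0..y}. h a) - \<epsilon> \<le> (INF a\<in>{0..y}. h' a)"
    using assms by (intro *) auto
  moreover have "(INF a\<in>{0..y}. h' a) - \<epsilon> \<le> (INF a\<in>{0..y}. h a)"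
    using assms by (intro *) (auto simp: abs_minus_commute)
  ultimately show ?thesis by (auto simp: envelope_def max_def)
qed

lemma continuous_on_envelope_interpolation:
  fixes h h' :: "real \<Rightarrow> real"
  assumes "continuous_on {0..y} h" "continuous_on {0..y} h'" "0 \<le> y"
  shows "continuous_on S (\<lambda>\<alpha>. envelope (\<lambda>a. (1 - \<alpha>) * h a + \<alpha> * h' a) y)"
proof -
  have "bounded ((\<lambda>a. h' a - h a) ` {0..y})"
    using assms by (intro compact_imp_bounded compact_continuous_image continuous_intros) auto
  then obtain M where M: "\<And>a. a \<in> {0..y} \<Longrightarrow> \<bar>h' a - h a\<bar> \<le> M"
    unfolding bounded_iff by (metis imageI real_norm_def)
  have "0 \<le> M" using M[of 0] assms by auto
  have lip: "\<bar>envelope (\<lambda>a. (1 - \<alpha>) * h a + \<alpha> * h' a) y - envelope (\<lambda>a. (1 - \<beta>) * h a + \<beta> * h' a) y\<bar>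
      \<le> M * \<bar>\<alpha> - \<beta>\<bar>" for \<alpha> \<beta>
  proof (rule envelope_lipschitz)
    fix a assume a: "a \<in> {0..y}"
    have "\<bar>(1 - \<alpha>) * h a + \<alpha> * h' a - ((1 - \<beta>) * h a + \<beta> * h' a)\<bar> = \<bar>h' a - h a\<bar> * \<bar>\<alpha> - \<beta>\<bar>"
      by (simp add: abs_mult[symmetric] algebra_simps)
    then show "\<bar>(1 - \<alpha>) * h a + \<alpha> * h' a - ((1 - \<beta>) * h a + \<beta> * h' a)\<bar> \<le> M * \<bar>\<alpha> - \<beta>\<bar>"
      using M[OF a] by (simp add: mult_right_mono)
  qed (use assms in \<open>auto intro!: continuous_intros\<close>)
  have "M-lipschitz_on S (\<lambda>\<alpha>. envelope (\<lambda>a. (1 - \<alpha>) * h a + \<alpha> * h' a) y)"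
    using lip \<open>0 \<le> M\<close> by (intro lipschitz_onI) (auto simp: dist_real_def)
  then show ?thesis by (rule lipschitz_on_continuous_on)
qed

text \<open>Before the least root every factor is positive and decreasing, so the infimum sits at
  the right endpoint and is the value of \<open>p\<close> there. From the least root on, the infimum
  is at most 0 and both sides vanish.\<close>

lemma truncation_eq_envelope:
  assumes Z: "finite Z" "Z \<subseteq> {0::real<..}" "Z \<noteq> {}" and p: "p = (\<Prod>z\<in>Z. [:1, - (1 / z):])"
    and y: "0 \<le> y"
  shows "poly p y * of_bool (y < first_zero p) = envelope (poly p) y"
proof -
  have pz: "poly p a = (\<Prod>z\<in>Z. 1 - a / z)" for a
    by (simp add: p poly_prod)
  have root: "poly p a = 0 \<longleftrightarrow> a \<in> Z" for a
    using Z by (auto simp: pz)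
  define m where "m = Min Z"
  have m: "m \<in> Z" "\<And>z. z \<in> Z \<Longrightarrow> m \<le> z" using Z by (auto simp: m_def)
  have "first_zero p = m"
    unfolding first_zero_def using m Z by (intro Least_equality) (auto simp: root intro: less_imp_le)
  have cont: "continuous_on {0..y} (poly p)" by (intro continuous_intros)
  show ?thesis
  proof (cases "y < m")
    case True
    have dec: "poly p y \<le> poly p a" if "a \<in> {0..y}" for a
      unfolding pz
    proof (rule prod_mono)
      fix z assume "z \<in> Z"
      then have "0 < z" "m \<le> z" using Z m by auto
      then show "0 \<le> 1 - y / z \<and> 1 - y / z \<le> 1 - a / z"
        using that True by (auto simp: field_simps)
    qed
    have "(INF a\<in>{0..y}. poly p a) = poly p y"
      using y by (intro cInf_eq_minimum) (auto intro: dec)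
    moreover have "0 \<le> poly p y"
      unfolding pz
    proof (rule prod_nonneg)
      fix z assume "z \<in> Z"
      then have "0 < z" "m \<le> z" using Z m by auto
      then show "0 \<le> 1 - y / z" using True by (auto simp: field_simps)
    qed
    ultimately show ?thesis
      using True \<open>first_zero p = m\<close> by (simp add: envelope_def)
  next
    case False
    have "0 < m" using m(1) Z by auto
    then have "(INF a\<in>{0..y}. poly p a) \<le> poly p m"
      using False cont bdd_below_cont by (intro cINF_lower) auto
    also have "\<dots> = 0" using root m by blast
    finally show ?thesis using False \<open>first_zero p = m\<close> by (simp add: envelope_def)
  qed
qed

subsection \<open>Residual polynomials of conjugate gradients\<close>

text \<open>Degree strictly below \<open>n\<close>, expressed through coefficients so that the zero
  polynomial also qualifies when \<open>n = 0\<close>.\<close>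

definition lowdeg :: "nat \<Rightarrow> real poly \<Rightarrow> bool" where
  "lowdeg n q \<longleftrightarrow> (\<forall>j\<ge>n. coeff q j = 0)"

lemma lowdeg_add: "lowdeg n p \<Longrightarrow> lowdeg n q \<Longrightarrow> lowdeg n (p + q)"
  and lowdeg_diff: "lowdeg n p \<Longrightarrow> lowdeg n q \<Longrightarrow> lowdeg n (p - q)"
  and lowdeg_smult: "lowdeg n p \<Longrightarrow> lowdeg n (Polynomial.smult a p)"
  and lowdeg_mono: "lowdeg n p \<Longrightarrow> n \<le> m \<Longrightarrow> lowdeg m p"
  and lowdeg_degree: "degree p < n \<Longrightarrow> lowdeg n p"
  by (auto simp: lowdeg_def coeff_eq_0)

lemma lowdeg_eq_0:
  assumes "lowdeg n p" "finite X" "n \<le> card X" "\<And>a. a \<in> X \<Longrightarrow> poly p a = 0"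
  shows "p = 0"
proof (rule ccontr)
  assume p: "p \<noteq> 0"
  have "degree p < n"
    using assms(1) p unfolding lowdeg_def by (meson leading_coeff_0_iff not_le)
  moreover have "card X \<le> card {a. poly p a = 0}"
    using assms by (intro card_mono poly_roots_finite p) auto
  then have "card X \<le> degree p" using card_poly_roots_bound[OF p] by linarith
  ultimately show False using assms(3) by simp
qed

text \<open>Gram--Schmidt in degree: each step adds the multiple of a monic orthogonal polynomial.\<close>

lemma weighted_projection:
  fixes x v f :: "nat \<Rightarrow> real"
  assumes v: "\<And>i. i < D \<Longrightarrow> 0 < v i" and "n \<le> card (x ` {..<D})"
  shows "\<exists>q. lowdeg n q \<and>
    (\<forall>s. lowdeg n s \<longrightarrow> (\<Sum>i<D. v i * (f i - poly q (x i)) * poly s (x i)) = 0)"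
  using assms(2)
proof (induction n arbitrary: f)
  case 0
  have "s = 0" if "lowdeg 0 s" for s using that by (simp add: lowdeg_def poly_eq_iff)
  then have "(\<Sum>i<D. v i * (f i - poly 0 (x i)) * poly s (x i)) = 0" if "lowdeg 0 s" for s
    using that by fastforce
  moreover have "lowdeg 0 0" by (simp add: lowdeg_def)
  ultimately show ?case by blast
next
  case (Suc n)
  obtain q1 where q1: "lowdeg n q1"
    "\<And>s. lowdeg n s \<Longrightarrow> (\<Sum>i<D. v i * (f i - poly q1 (x i)) * poly s (x i)) = 0"
    using Suc.IH[of f] Suc.prems by auto
  obtain q0 where q0: "lowdeg n q0"
    "\<And>s. lowdeg n s \<Longrightarrow> (\<Sum>i<D. v i * (x i ^ n - poly q0 (x i)) * poly s (x i)) = 0"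
    using Suc.IH[of "\<lambda>i. x i ^ n"] Suc.prems by auto
  define e where "e = monom 1 n - q0"
  have e_low: "lowdeg (Suc n) e" and e_coeff: "coeff e n = 1"
    using q0(1) by (auto simp: e_def lowdeg_def)
  have e_orth: "(\<Sum>i<D. v i * poly e (x i) * poly s (x i)) = 0" if "lowdeg n s" for s
    using q0(2)[OF that] by (simp add: e_def poly_monom)
  define E where "E = (\<Sum>i<D. v i * poly e (x i) * poly e (x i))"
  \<comment> \<open>The monic \<open>e\<close> of degree \<open>n\<close> cannot vanish at all of
    the at least \<open>n + 1\<close> distinct nodes.\<close>
  have "E \<noteq> 0"
  proof
    assume "E = 0"
    then have "\<forall>i\<in>{..<D}. v i * poly e (x i) * poly e (x i) = 0"
      unfolding E_def using v by (subst (asm) sum_nonneg_eq_0_iff) (auto simp: mult.assoc less_imp_le)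
    then have "poly e a = 0" if "a \<in> x ` {..<D}" for a
      using that v by force
    then have "e = 0" using e_low Suc.prems by (intro lowdeg_eq_0) auto
    then show False using e_coeff by simp
  qed
  define F where "F = (\<Sum>i<D. v i * (f i - poly q1 (x i)) * poly e (x i))"
  define \<beta> where "\<beta> = F / E"
  define q where "q = q1 + Polynomial.smult \<beta> e"
  have "lowdeg (Suc n) q"
    unfolding q_def using e_low q1(1) by (auto intro!: lowdeg_add lowdeg_smult elim: lowdeg_mono)
  moreover have "(\<Sum>i<D. v i * (f i - poly q (x i)) * poly s (x i)) = 0" if "lowdeg (Suc n) s" for s
  proof -
    \<comment> \<open>Removing the top coefficient with \<open>e\<close> leaves a test polynomial of
      degree below \<open>n\<close>, to which the orthogonality of \<open>q1\<close> and of
      \<open>e\<close> applies.\<close>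
    define t where "t = s - Polynomial.smult (coeff s n) e"
    have "coeff t j = 0" if "n \<le> j" for j
      using that e_coeff e_low \<open>lowdeg (Suc n) s\<close>
      by (cases "j = n") (auto simp: t_def lowdeg_def)
    then have t: "lowdeg n t" by (simp add: lowdeg_def)
    have s: "poly s a = poly t a + coeff s n * poly e a" for a by (simp add: t_def)
    have "(\<Sum>i<D. v i * (f i - poly q (x i)) * poly s (x i)) =
        (\<Sum>i<D. v i * (f i - poly q1 (x i)) * poly t (x i))
        + coeff s n * F - \<beta> * (\<Sum>i<D. v i * poly e (x i) * poly t (x i)) - \<beta> * coeff s n * E"
      unfolding F_def E_def sum_distrib_left sum.distrib[symmetric] sum_subtractf[symmetric]
      by (intro sum.cong refl) (simp add: s q_def algebra_simps)
    then show ?thesis using q1(2)[OF t] e_orth[OF t] \<open>E \<noteq> 0\<close> by (simp add: \<beta>_def)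
  qed
  ultimately show ?case by blast
qed

text \<open>Here \<open>x\<close> stands for the eigenvalues of the operator and \<open>c\<close>
  for the coordinates of the observation. Since no \<open>c i\<close> vanishes, zero energy forces a
  polynomial to vanish at every node.\<close>

locale krylov =
  fixes D :: nat and x c :: "nat \<Rightarrow> real"
  assumes x_pos: "i < D \<Longrightarrow> 0 < x i" and c_nz: "i < D \<Longrightarrow> c i \<noteq> 0"
begin

definition energy :: "real poly \<Rightarrow> real poly \<Rightarrow> real" where
  "energy p q = (\<Sum>i<D. (c i)\<^sup>2 * poly p (x i) * poly q (x i))"

text \<open>The multiples \<open>pCons 0 s\<close> of the variable are the directions that preserve
  the constraint of value 1 at 0, so this is the first-order condition for minimal energy in degree
  at most \<open>k\<close>.\<close>

definition orthogonal :: "nat \<Rightarrow> real poly \<Rightarrow> bool" where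
  "orthogonal k p \<longleftrightarrow> (\<forall>s. lowdeg k s \<longrightarrow> energy p (pCons 0 s) = 0)"

definition residual :: "nat \<Rightarrow> real poly \<Rightarrow> bool" where
  "residual k p \<longleftrightarrow> degree p \<le> k \<and> poly p 0 = 1 \<and> orthogonal k p"

abbreviation nodes :: "real set" where "nodes \<equiv> x ` {..<D}"

lemma energy_add: "energy (p + p') q = energy p q + energy p' q"
    "energy q (p + p') = energy q p + energy q p'"
  and energy_smult: "energy (Polynomial.smult a p) q = a * energy p q"
    "energy q (Polynomial.smult a p) = a * energy q p"
  and energy_diff: "energy (p - p') q = energy p q - energy p' q"
    "energy q (p - p') = energy q p - energy q p'"
  unfolding energy_def sum_distrib_left sum.distrib[symmetric] sum_subtractf[symmetric]
  by (intro sum.cong refl; simp add: algebra_simps)+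

lemma energy_commute: "energy p q = energy q p"
  by (simp add: energy_def mult_ac)

lemma energy_nonneg: "0 \<le> energy p p"
  by (auto simp: energy_def mult.assoc intro!: sum_nonneg)

lemma energy_self_eq_0:
  assumes "energy p p = 0" "i < D"
  shows "poly p (x i) = 0"
proof -
  have "\<forall>i\<in>{..<D}. (c i)\<^sup>2 * poly p (x i) * poly p (x i) = 0"
    using assms(1) unfolding energy_def by (subst (asm) sum_nonneg_eq_0_iff) (auto simp: mult.assoc)
  then show ?thesis using assms(2) c_nz by force
qed

lemma orthogonal_mono: "orthogonal m p \<Longrightarrow> k \<le> m \<Longrightarrow> orthogonal k p"
  by (auto simp: orthogonal_def intro: lowdeg_mono)

text \<open>Write the polynomial as 1 minus the variable times \<open>q\<close>. Orthogonality then
  says that \<open>q\<close> is the projection of the function \<open>1 / x\<close> with respect to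
  the weights \<open>c\<^sup>2 x\<^sup>2\<close>.\<close>

lemma ex_residual:
  assumes "k \<le> card nodes"
  shows "\<exists>p. residual k p"
proof -
  have "0 < (c i)\<^sup>2 * (x i)\<^sup>2" if "i < D" for i
    using x_pos[OF that] c_nz[OF that] by simp
  from weighted_projection[where v = "\<lambda>i. (c i)\<^sup>2 * (x i)\<^sup>2" and f = "\<lambda>i. 1 / x i", OF this assms]
  obtain q where q: "lowdeg k q"
    "\<And>s. lowdeg k s \<Longrightarrow>
      (\<Sum>i<D. (c i)\<^sup>2 * (x i)\<^sup>2 * (1 / x i - poly q (x i)) * poly s (x i)) = 0"
    by blast
  have "orthogonal k (pCons 1 (- q))"
    unfolding orthogonal_def
  proof (intro allI impI)
    fix s assume s: "lowdeg k s"
    have "energy (pCons 1 (- q)) (pCons 0 s) =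
        (\<Sum>i<D. (c i)\<^sup>2 * (x i)\<^sup>2 * (1 / x i - poly q (x i)) * poly s (x i))"
      unfolding energy_def
    proof (rule sum.cong)
      fix i assume "i \<in> {..<D}"
      then show "(c i)\<^sup>2 * poly (pCons 1 (- q)) (x i) * poly (pCons 0 s) (x i) =
          (c i)\<^sup>2 * (x i)\<^sup>2 * (1 / x i - poly q (x i)) * poly s (x i)"
        using x_pos[of i] by (simp add: field_simps power2_eq_square)
    qed simp
    then show "energy (pCons 1 (- q)) (pCons 0 s) = 0" using q(2)[OF s] by simp
  qed
  moreover have "degree (pCons 1 (- q)) \<le> k"
    using q(1) by (intro degree_le) (auto simp: lowdeg_def coeff_pCons split: nat.split)
  ultimately have "residual k (pCons 1 (- q))" by (simp only: residual_def) simp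
  then show ?thesis by blast
qed

text \<open>The difference \<open>q - p\<close> vanishes at 0, hence is an admissible direction and
  orthogonal to \<open>p\<close>.\<close>

lemma energy_residual:
  assumes p: "residual k p" and q: "degree q \<le> k" "poly q 0 = 1"
  shows "energy p q = energy p p"
proof -
  have "poly (q - p) 0 = 0" using p q by (simp add: residual_def)
  then obtain s where s: "q - p = pCons 0 s" by (cases "q - p") auto
  have "degree (q - p) \<le> k" using p q by (auto simp: residual_def intro: degree_diff_le)
  then have "lowdeg k s" unfolding lowdeg_def
    by (metis s coeff_eq_0 coeff_pCons_Suc le_imp_less_Suc le_less_trans)
  then have "energy p (q - p) = 0" using p s by (simp add: residual_def orthogonal_def)
  then show ?thesis by (simp add: energy_diff)
qed

lemma energy_residual_pythagoras:
  assumes p: "residual k p" and q: "degree q \<le> k" "poly q 0 = 1"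
  shows "energy q q = energy p p + energy (q - p) (q - p)"
  using energy_residual[OF assms] by (simp add: energy_diff energy_commute)

text \<open>By Pythagoras \<open>q - p\<close> has zero energy, so it vanishes at all nodes; it also
  vanishes at 0. These are more points than its degree allows.\<close>

lemma residual_unique:
  assumes p: "residual k p" and q: "degree q \<le> k" "poly q 0 = 1" "energy q q \<le> energy p p"
    and k: "k \<le> card nodes"
  shows "q = p"
proof -
  have "energy (q - p) (q - p) = 0"
    using energy_residual_pythagoras[OF p q(1,2)] q(3) energy_nonneg[of "q - p"] by linarith
  then have "poly (q - p) a = 0" if "a \<in> insert 0 nodes" for a
    using that energy_self_eq_0[of "q - p"] p q by (cases "a = 0") (auto simp: residual_def)
  moreover have "0 \<notin> nodes" using x_pos by (metis imageE lessThan_iff less_irrefl)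
  ultimately have "q - p = 0"
    using p q k by (intro lowdeg_eq_0[of "Suc k" _ "insert 0 nodes"] lowdeg_diff lowdeg_degree)
      (auto simp: residual_def)
  then show ?thesis by simp
qed

text \<open>
  Testing against \<open>p\<close> divided by its factor of constant sign shows that few sign changes force
  \<open>p\<close> to vanish at all nodes.
\<close>

lemma orthogonal_factorization:
  assumes p: "orthogonal k p" "poly p 0 = 1" "degree p \<le> card nodes" and k: "k \<le> card nodes"
  obtains Z s where "finite Z" "Z \<subseteq> {0<..}" "p = (\<Prod>z\<in>Z. [:1, - (1 / z):]) * s"
    "(\<forall>y>0. 0 \<le> poly s y) \<or> (\<forall>y>0. poly s y \<le> 0)" "k \<le> card Z"
proof -
  have "p \<noteq> 0" using p by auto
  then obtain Z s where Z: "finite Z" "Z \<subseteq> {0<..}" "p = (\<Prod>z\<in>Z. [:1, - (1 / z):]) * s"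
    "(\<forall>y>0. 0 \<le> poly s y) \<or> (\<forall>y>0. poly s y \<le> 0)"
    by (rule factor_constant_sign)
  show ?thesis
  proof (cases "k \<le> card Z")
    case True
    then show ?thesis using that Z by blast
  next
    case False
    define q where "q = (\<Prod>z\<in>Z. [:1, - (1 / z):])"
    have pq: "p = q * s" using Z(3) by (simp add: q_def)
    have "lowdeg k q" using False degree_prod_linear[OF Z(1,2)] by (auto simp: q_def intro: lowdeg_degree)
    then have "energy p (pCons 0 q) = 0" using p by (simp add: orthogonal_def)
    then have 0: "(\<Sum>i<D. (c i)\<^sup>2 * x i * (poly q (x i))\<^sup>2 * poly s (x i)) = 0"
      by (simp add: energy_def pq power2_eq_square mult_ac)
    have "\<forall>i\<in>{..<D}. (c i)\<^sup>2 * x i * (poly q (x i))\<^sup>2 * poly s (x i) = 0"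
      using Z(4)
    proof
      assume "\<forall>y>0. 0 \<le> poly s y"
      then have "0 \<le> (c i)\<^sup>2 * x i * (poly q (x i))\<^sup>2 * poly s (x i)" if "i < D" for i
        using x_pos[OF that] by simp
      then show ?thesis using 0 by (subst (asm) sum_nonneg_eq_0_iff) auto
    next
      assume "\<forall>y>0. poly s y \<le> 0"
      then have "(c i)\<^sup>2 * x i * (poly q (x i))\<^sup>2 * poly s (x i) \<le> 0" if "i < D" for i
        using x_pos[OF that] by (simp add: mult_nonneg_nonpos)
      then have "\<forall>i\<in>{..<D}. - ((c i)\<^sup>2 * x i * (poly q (x i))\<^sup>2 * poly s (x i)) = 0"
        using 0 by (subst sum_nonneg_eq_0_iff[symmetric]) (auto simp: sum_negf)
      then show ?thesis by simp
    qed
    then have "poly p (x i) = 0" if i: "i < D" for i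
      using i c_nz[OF i] x_pos[OF i] by (auto simp: pq)
    \<comment> \<open>Too few sign changes are thus possible only for the polynomial with all nodes
      as simple roots, and this one is factorised by \<open>Z = nodes\<close> and
      \<open>s = 1\<close>.\<close>
    then have "p = (\<Prod>z\<in>nodes. [:1, - (1 / z):])"
      using p x_pos by (intro prod_linear_unique) auto
    then show ?thesis using that[of nodes 1] x_pos k by auto
  qed
qed

text \<open>The \<open>m\<close> sign changes forced by orthogonality exhaust the degree, so
  \<open>s\<close> is constant, and it equals 1 by the value at 0.\<close>

lemma residual_factorization:
  assumes p: "residual m p" and m: "m \<le> card nodes"
  obtains Z where "finite Z" "Z \<subseteq> {0<..}" "p = (\<Prod>z\<in>Z. [:1, - (1 / z):])" "card Z = m"
proof -
  have "orthogonal m p" "poly p 0 = 1" "degree p \<le> card nodes" using p m by (auto simp: residual_def)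
  then obtain Z s where Z: "finite Z" "Z \<subseteq> {0<..}" "p = (\<Prod>z\<in>Z. [:1, - (1 / z):]) * s"
    "(\<forall>y>0. 0 \<le> poly s y) \<or> (\<forall>y>0. poly s y \<le> 0)" "m \<le> card Z"
    using m by (rule orthogonal_factorization)
  have "p \<noteq> 0" using p by (auto simp: residual_def)
  then have "degree p = card Z + degree s"
    unfolding Z(3) by (subst degree_mult_eq) (auto simp: degree_prod_linear[OF Z(1,2)])
  then have deg: "card Z = m" "degree s = 0" using p Z(5) by (auto simp: residual_def)
  then obtain b where "s = [:b:]" by (auto elim: degree_eq_zeroE)
  moreover have "poly p 0 = poly s 0" by (simp add: Z(3) poly_prod)
  ultimately have "s = 1" using p by (simp add: residual_def one_pCons)
  then show ?thesis using that Z deg by auto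
qed

text \<open>
  The convex combination loses one degree of orthogonality, hence possibly one root; the sign of
  its leading coefficient, inherited from the higher residual polynomial, recovers it.
\<close>

lemma interpolated_residual_factorization:
  assumes p: "residual k p" and q: "residual (Suc k) q" and k: "Suc k \<le> card nodes"
    and \<alpha>: "0 < \<alpha>" "\<alpha> \<le> 1"
  obtains Z where "finite Z" "Z \<subseteq> {0<..}" "Z \<noteq> {}"
    "Polynomial.smult (1 - \<alpha>) p + Polynomial.smult \<alpha> q = (\<Prod>z\<in>Z. [:1, - (1 / z):])"
proof -
  define r where "r = Polynomial.smult (1 - \<alpha>) p + Polynomial.smult \<alpha> q"
  have r0: "poly r 0 = 1" using p q by (simp add: r_def residual_def)
  have deg_r: "degree r \<le> Suc k"
    unfolding r_def using p q by (intro degree_add_le) (auto simp: residual_def intro: le_trans[OF degree_smult_le])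
  have "orthogonal k p" "orthogonal k q"
    using p q orthogonal_mono[of "Suc k" q k] by (auto simp: residual_def)
  then have "orthogonal k r" by (auto simp: orthogonal_def r_def energy_add energy_smult)
  moreover have "degree r \<le> card nodes" "k \<le> card nodes" using deg_r k by auto
  ultimately obtain Z s where Z: "finite Z" "Z \<subseteq> {0<..}" "r = (\<Prod>z\<in>Z. [:1, - (1 / z):]) * s"
    "(\<forall>y>0. 0 \<le> poly s y) \<or> (\<forall>y>0. poly s y \<le> 0)" "k \<le> card Z"
    using r0 by (elim orthogonal_factorization)
  define w where "w = (\<Prod>z\<in>Z. [:1, - (1 / z):])"
  have w: "r = w * s" "degree w = card Z" "poly w 0 = 1" "0 < (- 1) ^ card Z * lead_coeff w"
    using Z(3) degree_prod_linear[OF Z(1,2)] lead_coeff_prod_linear_sign[OF Z(1,2)]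
    by (simp_all add: w_def poly_prod)
  have "r \<noteq> 0" using r0 by auto
  then have "degree r = card Z + degree s"
    unfolding w(1) by (subst degree_mult_eq) (auto simp: w(2))
  then have "card Z + degree s \<le> Suc k" using deg_r by simp
  then have "degree s \<le> 1" "card Z = Suc k \<Longrightarrow> degree s = 0" using Z(5) by auto
  have s0: "poly s 0 = 1" using r0 w by simp
  obtain a s' where s': "s = pCons a s'" by (cases s)
  then have "degree s' = 0" using \<open>degree s \<le> 1\<close> by (cases "s' = 0") auto
  then obtain b where "s' = [:b:]" by (auto elim: degree_eq_zeroE)
  then have s: "s = [:1, b:]" using s' s0 by simp
  \<comment> \<open>With only \<open>k\<close> roots, compare coefficients of degree
    \<open>k + 1\<close>, where \<open>p\<close> contributes nothing: \<open>b\<close> times the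
    leading coefficient of \<open>w\<close> is \<alpha> times that of \<open>q\<close>. These two
    have opposite signs, so \<open>b < 0\<close> and \<open>s\<close> changes sign on the positive
    axis.\<close>
  have "card Z = Suc k"
  proof (rule ccontr)
    assume "card Z \<noteq> Suc k"
    then have cZ: "card Z = k" using Z(5) \<open>card Z + degree s \<le> Suc k\<close> by linarith
    obtain Z' where Z': "finite Z'" "Z' \<subseteq> {0<..}" "q = (\<Prod>z\<in>Z'. [:1, - (1 / z):])" "card Z' = Suc k"
      using residual_factorization[OF q k] by metis
    have "degree q = Suc k" using Z' degree_prod_linear by simp
    then have "0 < (- 1) ^ Suc k * coeff q (Suc k)"
      using lead_coeff_prod_linear_sign[OF Z'(1,2)] Z' by simp
    moreover have "coeff r (Suc k) = \<alpha> * coeff q (Suc k)"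
      using p by (simp add: r_def residual_def coeff_eq_0)
    moreover have "coeff r (Suc k) = b * coeff w k"
      using w(2) cZ by (simp add: w(1) s coeff_eq_0)
    ultimately have "b * coeff w k = \<alpha> * coeff q (Suc k)" and "0 < (- 1) ^ Suc k * coeff q (Suc k)"
      by simp_all
    moreover have "0 < \<alpha> * ((- 1) ^ Suc k * coeff q (Suc k))" using calculation(2) \<alpha>(1) by (rule mult_pos_pos[rotated])
    ultimately have "0 < (- 1) ^ Suc k * (b * coeff w k)" by (simp only: mult.left_commute)
    then have neg: "b * ((- 1) ^ k * coeff w k) < 0" by (simp only: mult.left_commute power_Suc mult_minus_left mult_1_left neg_0_less_iff_less)
    have pos: "0 < (- 1) ^ k * coeff w k" using w(2,4) unfolding cZ by simp
    have "b < 0"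
    proof (rule ccontr)
      assume "\<not> b < 0"
      then show False using neg mult_nonneg_nonneg[of b "(- 1) ^ k * coeff w k"] pos by linarith
    qed
    \<comment> \<open>The two test points lie on either side of the root \<open>- 1 / b\<close> of
      \<open>s\<close>.\<close>
    then have vals: "poly s (- (2 / b)) = - 1" "poly s (- (1 / (2 * b))) = 1 / 2"
      and pos: "0 < - (2 / b)" "0 < - (1 / (2 * b))" by (simp_all add: s)
    from Z(4) show False
    proof
      assume "\<forall>y>0. 0 \<le> poly s y"
      then have "0 \<le> poly s (- (2 / b))" using pos(1) by blast
      then show False using vals(1) by simp
    next
      assume "\<forall>y>0. poly s y \<le> 0"
      then have "poly s (- (1 / (2 * b))) \<le> 0" using pos(2) by blast
      then show False using vals(2) by simp
    qed
  qed
  then have "s = 1"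
    using \<open>card Z = Suc k \<Longrightarrow> degree s = 0\<close> by (cases "b = 0") (simp_all add: s one_pCons)
  then have "r = (\<Prod>z\<in>Z. [:1, - (1 / z):])" using Z(3) by simp
  moreover have "Z \<noteq> {}" using \<open>card Z = Suc k\<close> by auto
  ultimately show ?thesis using that[OF Z(1,2)] unfolding r_def by blast
qed

end

subsection \<open>Balancing the error terms\<close>

text \<open>By continuity the sublevel set is closed, and it contains \<open>b\<close>, so the
  infimum is attained. If the value at a positive infimum were strictly below \<kappa>, the
  intermediate value theorem would give an earlier crossing.\<close>

lemma first_passage:
  fixes h :: "real \<Rightarrow> real"
  assumes h: "continuous_on {0..b} h" and b: "0 \<le> b" "h b \<le> \<kappa>"
  defines "\<tau> \<equiv> Inf {t \<in> {0..b}. h t \<le> \<kappa>}"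
  shows "\<tau> \<in> {0..b}" "h \<tau> \<le> \<kappa>" "\<tau> = 0 \<or> h \<tau> = \<kappa>"
proof -
  let ?T = "{t \<in> {0..b}. h t \<le> \<kappa>}"
  have "closed ({0..b} \<inter> h -` {..\<kappa>})"
    using h by (intro continuous_closed_preimage) auto
  moreover have "{0..b} \<inter> h -` {..\<kappa>} = ?T" by auto
  ultimately have "closed ?T" by simp
  moreover have bdd: "bdd_below ?T" by (auto intro!: bdd_belowI[of _ 0])
  moreover have "?T \<noteq> {}" using b by auto
  ultimately have "\<tau> \<in> ?T" unfolding \<tau>_def by (intro closed_contains_Inf)
  then show \<tau>: "\<tau> \<in> {0..b}" "h \<tau> \<le> \<kappa>" by auto
  show "\<tau> = 0 \<or> h \<tau> = \<kappa>"
  proof (rule ccontr)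
    assume "\<not> ?thesis"
    then have *: "0 < \<tau>" "h \<tau> < \<kappa>" using \<tau> by auto
    have "h s > \<kappa>" if "0 \<le> s" "s < \<tau>" for s
    proof (rule ccontr)
      assume "\<not> h s > \<kappa>"
      then have "s \<in> ?T" using that \<tau> by auto
      then have "\<tau> \<le> s" unfolding \<tau>_def using bdd by (rule cInf_lower)
      then show False using that by simp
    qed
    then have above: "\<kappa> < h 0" "\<And>s. 0 \<le> s \<Longrightarrow> s < \<tau> \<Longrightarrow> \<kappa> < h s" using * by auto
    have "continuous_on {0..\<tau>} h" using h \<tau> by (auto intro: continuous_on_subset)
    then obtain s where "0 \<le> s" "s \<le> \<tau>" "h s = \<kappa>"
      using IVT2'[of h \<tau> \<kappa> 0] * above(1) by auto
    then show False using above(2)[of s] * by (cases "s = \<tau>") auto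
  qed
qed

lemma continuous_on_pieces:
  fixes h :: "real \<Rightarrow> 'a :: topological_space"
  assumes "\<And>k. k < n \<Longrightarrow> continuous_on {real k..real (Suc k)} h"
  shows "continuous_on {0..real n} h"
  using assms
proof (induction n)
  case (Suc n)
  have "{0..real (Suc n)} = {0..real n} \<union> {real n..real (Suc n)}" by auto
  then show ?case using Suc by (simp only:) (intro continuous_on_closed_Un; simp)
qed simp

text \<open>A weight increasing from 0 to 1 is a mixture of the indicators of the tails.\<close>

lemma weighted_sum_le_max_tail:
  fixes \<psi> w :: "nat \<Rightarrow> real"
  assumes "\<And>i j. i \<le> j \<Longrightarrow> j < D \<Longrightarrow> \<psi> i \<le> \<psi> j" "\<And>i. i < D \<Longrightarrow> a \<le> \<psi> i" "\<And>i. i < D \<Longrightarrow> \<psi> i \<le> 1"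
    "a \<le> 1" "0 \<le> M" "\<And>m. m < D \<Longrightarrow> (\<Sum>i\<in>{m..<D}. w i) \<le> M"
  shows "(\<Sum>i<D. (\<psi> i - a) * w i) \<le> (1 - a) * M"
  using assms
proof (induction D arbitrary: \<psi> w a)
  case (Suc D)
  \<comment> \<open>Summation by parts: the increment \<open>\<psi> 0 - a\<close> is common to all
    indices and multiplies the full sum; what remains is the shifted problem with base value \<psi>
    0.\<close>
  have "(\<Sum>i<D. (\<psi> (Suc i) - \<psi> 0) * w (Suc i)) \<le> (1 - \<psi> 0) * M"
  proof (rule Suc.IH)
    fix m assume "m < D"
    have "(\<Sum>i = m..<D. w (Suc i)) = sum w {Suc m..<Suc D}" by (rule sum.shift_bounds_Suc_ivl[symmetric])
    then show "(\<Sum>i = m..<D. w (Suc i)) \<le> M" using Suc.prems(6)[of "Suc m"] \<open>m < D\<close> by simp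
  qed (use Suc.prems in auto)
  then have "(\<Sum>i<Suc D. (\<psi> i - \<psi> 0) * w i) \<le> (1 - \<psi> 0) * M"
    unfolding sum.lessThan_Suc_shift by simp
  moreover have "(\<psi> 0 - a) * (\<Sum>i<Suc D. w i) \<le> (\<psi> 0 - a) * M"
    using Suc.prems(2)[of 0] Suc.prems(6)[of 0] by (intro mult_left_mono) (auto simp: atLeast0LessThan)
  moreover have "(\<Sum>i<Suc D. (\<psi> i - a) * w i) =
      (\<psi> 0 - a) * (\<Sum>i<Suc D. w i) + (\<Sum>i<Suc D. (\<psi> i - \<psi> 0) * w i)"
    unfolding sum_distrib_left sum.distrib[symmetric] by (intro sum.cong refl) (simp add: algebra_simps)
  ultimately show ?case by (simp only: left_diff_distrib mult_1_left)
qed simp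

text \<open>One fixed time in spectral coordinates: \<open>g\<close> and \<open>e\<close> are signal
  and noise, \<open>r\<close> and \<open>\<phi>\<close> the values of the residual polynomial and of
  its truncation at the eigenvalues. Of the truncation only its range and \<open>\<phi>_cut\<close>
  are kept.\<close>

locale balanced_errors =
  fixes D :: nat and g e r \<phi> :: "nat \<Rightarrow> real" and S A L :: real
  assumes \<phi>_bounds: "i < D \<Longrightarrow> 0 \<le> \<phi> i" "i < D \<Longrightarrow> \<phi> i \<le> 1"
    and \<phi>_cut: "i < D \<Longrightarrow> \<phi> i = r i \<or> \<phi> i = 0"
    and S_def: "S = (\<Sum>i<D. (1 - \<phi> i) * (e i)\<^sup>2)"
    and A_def: "A = (\<Sum>i<D. \<phi> i * (g i)\<^sup>2) + (\<Sum>i<D. (r i * (g i + e i))\<^sup>2)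
      - (\<Sum>i<D. \<phi> i * (g i + e i)\<^sup>2)"
    and L_def: "L = (\<Sum>i<D. (e i - r i * (g i + e i))\<^sup>2)"
    and balanced: "A \<le> S"
begin

text \<open>
  The difference \<open>S + A - L\<close> equals \<open>2 \<langle>(r - \<phi>) Y, \<xi>\<rangle>\<close>, which only sees indices with \<open>\<phi> = 0\<close>.
\<close>

lemma loss_le_combination: "L \<le> 10 * S + 2 * A" and A_ge: "- 5 * S - L / 2 \<le> A - L"
proof -
  have eq: "S + A - L = (\<Sum>i<D. 2 * ((r i - \<phi> i) * (g i + e i) * e i))"
    unfolding S_def A_def L_def sum.distrib[symmetric] sum_subtractf[symmetric]
    by (intro sum.cong refl) (simp add: algebra_simps power2_eq_square)
  have "\<bar>\<Sum>i<D. 2 * ((r i - \<phi> i) * (g i + e i) * e i)\<bar> \<le>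
      (\<Sum>i<D. 4 * ((1 - \<phi> i) * (e i)\<^sup>2) + (e i - r i * (g i + e i))\<^sup>2 / 2)"
  proof (rule order_trans[OF sum_abs], rule sum_mono)
    fix i assume "i \<in> {..<D}"
    then have i: "i < D" by simp
    show "\<bar>2 * ((r i - \<phi> i) * (g i + e i) * e i)\<bar> \<le>
        4 * ((1 - \<phi> i) * (e i)\<^sup>2) + (e i - r i * (g i + e i))\<^sup>2 / 2"
    \<comment> \<open>With \<open>l\<close> the loss coordinate, the term is
      \<open>2 e\<^sup>2 - 2 l e\<close>, and
      \<open>2 \<bar>l e\<bar> \<le> 2 e\<^sup>2 + l\<^sup>2 / 2\<close>. At such an index
      \<open>e\<^sup>2\<close> is the full summand of \<open>S\<close>. At all other indices the
      term is zero.\<close>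
    proof (cases "\<phi> i = 0")
      case True
      define l where "l = e i - r i * (g i + e i)"
      have eq': "2 * ((r i - \<phi> i) * (g i + e i) * e i) = 2 * (e i)\<^sup>2 - 2 * l * e i"
        using True by (simp add: l_def algebra_simps power2_eq_square)
      have "(2 * e i + l)\<^sup>2 = 4 * (e i)\<^sup>2 + 2 * (2 * l * e i) + l\<^sup>2"
        "(2 * e i - l)\<^sup>2 = 4 * (e i)\<^sup>2 - 2 * (2 * l * e i) + l\<^sup>2"
        by (simp_all add: power2_eq_square algebra_simps)
      then have "0 \<le> 4 * (e i)\<^sup>2 + 2 * (2 * l * e i) + l\<^sup>2" "0 \<le> 4 * (e i)\<^sup>2 - 2 * (2 * l * e i) + l\<^sup>2"
        by (metis zero_le_power2)+
      then have "\<bar>2 * (e i)\<^sup>2 - 2 * l * e i\<bar> \<le> 4 * (e i)\<^sup>2 + l\<^sup>2 / 2"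
        unfolding abs_le_iff using zero_le_power2[of "e i"] by linarith
      then show ?thesis using True unfolding eq' l_def by simp
    next
      case False
      then have "r i = \<phi> i" using \<phi>_cut[OF i] by auto
      then show ?thesis using \<phi>_bounds[OF i] by simp
    qed
  qed
  also have "\<dots> = 4 * S + L / 2"
    by (simp add: S_def L_def sum.distrib sum_distrib_left sum_divide_distrib)
  finally have "\<bar>S + A - L\<bar> \<le> 4 * S + L / 2" unfolding eq .
  then show "L \<le> 10 * S + 2 * A" "- 5 * S - L / 2 \<le> A - L" by linarith+
qed

lemma L_nonneg: "0 \<le> L" by (simp add: L_def sum_nonneg)

lemma S_nonneg: "0 \<le> S"
  unfolding S_def using \<phi>_bounds by (auto intro!: sum_nonneg)

lemma loss_le: "L \<le> 12 * S"
  using loss_le_combination balanced by linarith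

lemma approx_ge: "- 5 * S \<le> A"
  using A_ge L_nonneg by linarith

text \<open>Where \<open>\<phi>\<close> does not vanish, \<open>\<phi> g\<close> is
  \<open>(1 - \<phi>) e\<close> minus the loss coordinate, so the sum is at most
  \<open>2 * S + 2 * L\<close>, and \<open>L \<le> 12 * S\<close>.\<close>

lemma signal_le: "(\<Sum>i<D. (\<phi> i * g i)\<^sup>2) \<le> 26 * S"
proof -
  have "(\<Sum>i<D. (\<phi> i * g i)\<^sup>2) \<le>
      (\<Sum>i<D. 2 * ((1 - \<phi> i) * (e i)\<^sup>2) + 2 * (e i - r i * (g i + e i))\<^sup>2)"
  proof (rule sum_mono)
    fix i assume "i \<in> {..<D}"
    then have i: "i < D" by simp
    have *: "(1 - \<phi> i)\<^sup>2 * (e i)\<^sup>2 \<le> (1 - \<phi> i) * (e i)\<^sup>2"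
      using \<phi>_bounds[OF i] by (intro mult_right_mono) (auto simp: power2_eq_square mult_left_le)
    have nn: "0 \<le> (1 - \<phi> i) * (e i)\<^sup>2" using \<phi>_bounds[OF i] by simp
    show "(\<phi> i * g i)\<^sup>2 \<le> 2 * ((1 - \<phi> i) * (e i)\<^sup>2) + 2 * (e i - r i * (g i + e i))\<^sup>2"
    proof (cases "\<phi> i = 0")
      case False
      then have r: "r i = \<phi> i" using \<phi>_cut[OF i] by auto
      have "(\<phi> i * g i)\<^sup>2 = ((1 - \<phi> i) * e i - (e i - r i * (g i + e i)))\<^sup>2"
        by (simp add: r algebra_simps)
      also have "\<dots> \<le> 2 * ((1 - \<phi> i) * e i)\<^sup>2 + 2 * (e i - r i * (g i + e i))\<^sup>2"
        by (smt (verit) power2_sum power2_diff zero_le_power2)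
      finally show ?thesis using * by (simp add: power_mult_distrib)
    qed (use nn in simp)
  qed
  also have "\<dots> = 2 * S + 2 * L" by (simp add: S_def L_def sum.distrib sum_distrib_left)
  finally show ?thesis using loss_le by linarith
qed

text \<open>
  Where \<open>\<phi> \<le> 1/2\<close>, the noise is controlled by \<open>S\<close>; where \<open>\<phi> > 1/2\<close>, the quadratic form of
  \<open>\<phi>\<close> is controlled by that of \<open>\<phi>\<^sup>2\<close>.
\<close>

lemma cross_le:
  assumes mono: "\<And>i j. i \<le> j \<Longrightarrow> j < D \<Longrightarrow> \<phi> i \<le> \<phi> j"
    and M: "0 \<le> M" "\<And>m. m < D \<Longrightarrow> \<bar>\<Sum>i\<in>{m..<D}. g i * e i\<bar> - (\<Sum>i\<in>{m..<D}. (g i)\<^sup>2) \<le> M"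
  shows "\<bar>\<Sum>i<D. \<phi> i * g i * e i\<bar> \<le> 66 * S + M"
proof -
  \<comment> \<open>Thresholding keeps the weight monotone in the index, so the tail-sum bound
    applies to \<psi>.\<close>
  define \<psi> where "\<psi> i = (if 1 / 2 < \<phi> i then \<phi> i else 0)" for i
  have tail: "(\<Sum>i<D. \<psi> i * (\<sigma> * (g i * e i))) - (\<Sum>i<D. \<psi> i * (g i)\<^sup>2) \<le> M" if "\<bar>\<sigma>\<bar> = 1" for \<sigma> :: real
  proof -
    have "(\<Sum>i<D. (\<psi> i - 0) * (\<sigma> * (g i * e i) - (g i)\<^sup>2)) \<le> (1 - 0) * M"
    proof (rule weighted_sum_le_max_tail)
      fix i j :: nat assume "i \<le> j" "j < D"
      then show "\<psi> i \<le> \<psi> j" using mono[of i j] by (auto simp: \<psi>_def)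
    next
      fix m assume "m < D"
      have "(\<Sum>i = m..<D. \<sigma> * (g i * e i) - (g i)\<^sup>2) =
          \<sigma> * (\<Sum>i\<in>{m..<D}. g i * e i) - (\<Sum>i\<in>{m..<D}. (g i)\<^sup>2)"
        by (simp add: sum_subtractf sum_distrib_left)
      also have "\<sigma> * (\<Sum>i\<in>{m..<D}. g i * e i) \<le> \<bar>\<Sum>i\<in>{m..<D}. g i * e i\<bar>"
        using that abs_ge_self[of "\<sigma> * (\<Sum>i\<in>{m..<D}. g i * e i)"] by (simp add: abs_mult)
      finally show "(\<Sum>i = m..<D. \<sigma> * (g i * e i) - (g i)\<^sup>2) \<le> M" using M(2)[OF \<open>m < D\<close>] by linarith
    qed (use \<phi>_bounds M in \<open>auto simp: \<psi>_def\<close>)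
    then show ?thesis by (simp add: right_diff_distrib sum_subtractf)
  qed
  have "\<bar>\<Sum>i<D. \<psi> i * (g i * e i)\<bar> \<le> M + (\<Sum>i<D. \<psi> i * (g i)\<^sup>2)"
    using tail[of 1] tail[of "- 1"] by (simp add: sum_negf abs_le_iff)
  also have "(\<Sum>i<D. \<psi> i * (g i)\<^sup>2) \<le> (\<Sum>i<D. 2 * (\<phi> i * g i)\<^sup>2)"
  proof (rule sum_mono)
    fix i assume "i \<in> {..<D}"
    then have i: "i < D" by simp
    have "\<psi> i \<le> 2 * (\<phi> i)\<^sup>2" by (auto simp: \<psi>_def power2_eq_square)
    then have "\<psi> i * (g i)\<^sup>2 \<le> 2 * (\<phi> i)\<^sup>2 * (g i)\<^sup>2" by (intro mult_right_mono) auto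
    then show "\<psi> i * (g i)\<^sup>2 \<le> 2 * (\<phi> i * g i)\<^sup>2" by (simp add: power_mult_distrib)
  qed
  also have "\<dots> \<le> 52 * S" using signal_le by (simp add: sum_distrib_left[symmetric])
  finally have large: "\<bar>\<Sum>i<D. \<psi> i * (g i * e i)\<bar> \<le> M + 52 * S" by simp
  have "\<bar>\<Sum>i<D. (\<phi> i - \<psi> i) * (g i * e i)\<bar> \<le>
      (\<Sum>i<D. (\<phi> i * g i)\<^sup>2 / 2 + (1 - \<phi> i) * (e i)\<^sup>2)"
  proof (rule order_trans[OF sum_abs], rule sum_mono)
    fix i assume "i \<in> {..<D}"
    then have i: "i < D" by simp
    show "\<bar>(\<phi> i - \<psi> i) * (g i * e i)\<bar> \<le> (\<phi> i * g i)\<^sup>2 / 2 + (1 - \<phi> i) * (e i)\<^sup>2"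
    proof (cases "1 / 2 < \<phi> i")
      case True
      then show ?thesis using \<phi>_bounds[OF i] by (simp add: \<psi>_def)
    next
      case False
      have "\<bar>(\<phi> i * g i) * e i\<bar> \<le> (\<phi> i * g i)\<^sup>2 / 2 + (e i)\<^sup>2 / 2"
        using sum_squares_bound[of "\<bar>\<phi> i * g i\<bar>" "\<bar>e i\<bar>"]
        unfolding abs_mult[of "\<phi> i * g i" "e i"] power2_abs by linarith
      also have "(e i)\<^sup>2 / 2 \<le> (1 - \<phi> i) * (e i)\<^sup>2"
        using False mult_right_mono[of "1 / 2" "1 - \<phi> i" "(e i)\<^sup>2"] by simp
      finally show ?thesis using False by (simp add: \<psi>_def mult.assoc)
    qed
  qed
  also have "\<dots> \<le> 14 * S"
    using signal_le by (simp add: sum.distrib S_def sum_divide_distrib[symmetric])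
  finally have small: "\<bar>\<Sum>i<D. (\<phi> i - \<psi> i) * (g i * e i)\<bar> \<le> 14 * S" .
  have "(\<Sum>i<D. \<phi> i * g i * e i) = (\<Sum>i<D. \<psi> i * (g i * e i)) + (\<Sum>i<D. (\<phi> i - \<psi> i) * (g i * e i))"
    unfolding sum.distrib[symmetric] by (intro sum.cong refl) (simp add: algebra_simps)
  then show ?thesis using large small by linarith
qed

text \<open>The difference equals \<open>A - S\<close> plus twice the cross term. The former lies
  between \<open>- 6 * S\<close> and 0, and the cross term is at most \<open>66 * S + M\<close>;
  hence 138 = 6 + 2 * 66.\<close>

lemma residual_norm_close:
  assumes mono: "\<And>i j. i \<le> j \<Longrightarrow> j < D \<Longrightarrow> \<phi> i \<le> \<phi> j"
    and M: "0 \<le> M" "\<And>m. m < D \<Longrightarrow> \<bar>\<Sum>i\<in>{m..<D}. g i * e i\<bar> - (\<Sum>i\<in>{m..<D}. (g i)\<^sup>2) \<le> M"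
  shows "\<bar>(\<Sum>i<D. (r i * (g i + e i))\<^sup>2) - (\<Sum>i<D. (e i)\<^sup>2)\<bar> \<le> 138 * S + 2 * M"
proof -
  have "(\<Sum>i<D. (r i * (g i + e i))\<^sup>2) - (\<Sum>i<D. (e i)\<^sup>2) = A - S + 2 * (\<Sum>i<D. \<phi> i * g i * e i)"
    unfolding A_def S_def sum_distrib_left sum.distrib[symmetric] sum_subtractf[symmetric]
    by (intro sum.cong refl) (simp add: algebra_simps power2_eq_square)
  then show ?thesis using cross_le[OF assms] balanced approx_ge S_nonneg by linarith
qed

end

subsection \<open>Interpolated residual polynomials\<close>

locale interpolated_residuals = krylov +
  fixes r :: "nat \<Rightarrow> real poly"
  assumes residual_r: "k \<le> card nodes \<Longrightarrow> residual k (r k)"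
begin

definition interp :: "real \<Rightarrow> real poly" where
  "interp t = (if t \<le> 0 then r 0
    else (let k = nat (\<lceil>t\<rceil> - 1); \<alpha> = t - real k in
      Polynomial.smult (1 - \<alpha>) (r k) + Polynomial.smult \<alpha> (r (Suc k))))"

text \<open>At the left endpoint the definition uses the preceding piece with weight 1, or the
  convention at 0. All give \<open>r k\<close>, so one formula is valid on the closed
  interval.\<close>

lemma interp_on_piece:
  assumes "real k \<le> t" "t \<le> real (Suc k)"
  shows "interp t = Polynomial.smult (1 - (t - real k)) (r k) + Polynomial.smult (t - real k) (r (Suc k))"
proof (cases "t = real k")
  case True
  show ?thesis
  proof (cases k)
    case (Suc j)
    have "\<lceil>t\<rceil> = int k" unfolding True by (rule ceiling_of_nat)
    then have "nat (\<lceil>t\<rceil> - 1) = j" using Suc by simp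
    then show ?thesis using True Suc by (simp add: interp_def Let_def)
  qed (use True in \<open>simp add: interp_def\<close>)
next
  case False
  then have "\<lceil>t\<rceil> = int k + 1" using assms by (intro ceiling_unique) auto
  then show ?thesis using False assms by (simp add: interp_def Let_def)
qed

lemma piece:
  assumes "0 < t" "t \<le> real n"
  obtains k where "real k < t" "t \<le> real (Suc k)" "k < n"
proof
  define k where "k = nat (\<lceil>t\<rceil> - 1)"
  have "real k = real_of_int \<lceil>t\<rceil> - 1" using assms by (simp add: k_def)
  then show "real k < t" "t \<le> real (Suc k)" by linarith+
  then show "k < n" using assms by linarith
qed

lemma interp_factorization:
  assumes "0 < t" "t \<le> real (card nodes)"
  obtains Z where "finite Z" "Z \<subseteq> {0<..}" "Z \<noteq> {}" "interp t = (\<Prod>z\<in>Z. [:1, - (1 / z):])"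
proof -
  obtain k where k: "real k < t" "t \<le> real (Suc k)" "k < card nodes"
    using piece[OF assms] by blast
  have "residual k (r k)" "residual (Suc k) (r (Suc k))" "Suc k \<le> card nodes"
    using k residual_r by auto
  then obtain Z where "finite Z" "Z \<subseteq> {0<..}" "Z \<noteq> {}"
    "Polynomial.smult (1 - (t - real k)) (r k) + Polynomial.smult (t - real k) (r (Suc k)) =
      (\<Prod>z\<in>Z. [:1, - (1 / z):])"
    using k by (elim interpolated_residual_factorization[of k "r k" "r (Suc k)" "t - real k"]) auto
  then show ?thesis using that interp_on_piece[of k t] k by simp
qed

lemma r_0: "r 0 = 1"
proof -
  have "degree (r 0) = 0" "poly (r 0) 0 = 1" using residual_r[of 0] by (auto simp: residual_def)
  then show ?thesis by (auto elim!: degree_eq_zeroE simp: one_pCons)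
qed

lemma interp_at_0:
  assumes "0 \<le> t" "t \<le> real (card nodes)"
  shows "poly (interp t) 0 = 1"
proof (cases "t = 0")
  case True
  then show ?thesis by (simp add: interp_def r_0)
next
  case False
  then have "0 < t" using assms by simp
  then show ?thesis using assms(2) by (elim interp_factorization) (simp_all add: poly_prod)
qed

definition cut :: "real \<Rightarrow> real \<Rightarrow> real" where
  "cut t y = envelope (poly (interp t)) y"

text \<open>This identifies \<open>cut\<close> with the truncated polynomial. At time 0 the
  polynomial is 1, whose envelope is 1, in agreement with the separate convention there.\<close>

lemma truncated_interp:
  assumes "0 \<le> t" "t \<le> real (card nodes)" "0 \<le> y"
  shows "(if t \<le> 0 then 1 else poly (interp t) y * of_bool (y < first_zero (interp t))) = cut t y"
proof (cases "t = 0")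
  case True
  then show ?thesis using assms(3) by (simp add: interp_def r_0 cut_def envelope_def)
next
  case False
  then have t: "0 < t" using assms by simp
  then obtain Z where "finite Z" "Z \<subseteq> {0<..}" "Z \<noteq> {}" "interp t = (\<Prod>z\<in>Z. [:1, - (1 / z):])"
    using assms(2) by (elim interp_factorization)
  from truncation_eq_envelope[OF this assms(3)] show ?thesis using t by (simp add: cut_def)
qed

lemma cut_bounds:
  assumes "0 \<le> t" "t \<le> real (card nodes)" "0 \<le> y"
  shows "0 \<le> cut t y" "cut t y \<le> 1"
  using assms interp_at_0 unfolding cut_def
  by (intro envelope_bounds continuous_intros; simp)+

lemma cut_antimono: "0 \<le> y \<Longrightarrow> y \<le> y' \<Longrightarrow> cut t y' \<le> cut t y"
  unfolding cut_def by (intro envelope_antimono continuous_intros)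

lemma cut_cases:
  assumes "0 \<le> t" "t \<le> real (card nodes)" "0 \<le> y"
  shows "cut t y = poly (interp t) y \<or> cut t y = 0"
proof (cases "t = 0")
  case True
  then show ?thesis using truncated_interp[OF assms] by (simp add: interp_def r_0)
next
  case False
  then show ?thesis
    using truncated_interp[OF assms] assms by (cases "y < first_zero (interp t)") auto
qed

lemma continuous_on_interp: "continuous_on {0..real n} (\<lambda>t. poly (interp t) y)"
proof (rule continuous_on_pieces)
  fix k
  have "continuous_on {real k..real (Suc k)}
      (\<lambda>t. (1 - (t - real k)) * poly (r k) y + (t - real k) * poly (r (Suc k)) y)"
    by (intro continuous_intros)
  then show "continuous_on {real k..real (Suc k)} (\<lambda>t. poly (interp t) y)"
    by (rule continuous_on_eq) (simp add: interp_on_piece[of k])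
qed

lemma continuous_on_cut:
  assumes "0 \<le> y"
  shows "continuous_on {0..real n} (\<lambda>t. cut t y)"
proof (rule continuous_on_pieces)
  fix k
  have "continuous_on {real k..real (Suc k)} (\<lambda>t. (\<lambda>\<alpha>. envelope
      (\<lambda>a. (1 - \<alpha>) * poly (r k) a + \<alpha> * poly (r (Suc k)) a) y) (t - real k))"
    by (rule continuous_on_compose2[of UNIV])
      (auto intro!: continuous_on_envelope_interpolation continuous_intros assms)
  then show "continuous_on {real k..real (Suc k)} (\<lambda>t. cut t y)"
  proof (rule continuous_on_eq)
    fix t assume "t \<in> {real k..real (Suc k)}"
    then have "poly (interp t) = (\<lambda>a. (1 - (t - real k)) * poly (r k) a + (t - real k) * poly (r (Suc k)) a)"
      by (simp add: interp_on_piece[of k] fun_eq_iff)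
    then show "envelope (\<lambda>a. (1 - (t - real k)) * poly (r k) a + (t - real k) * poly (r (Suc k)) a) y = cut t y"
      by (simp add: cut_def)
  qed
qed

text \<open>A residual polynomial of lower degree is a competitor in the larger problem, so the Gram
  matrix of the sequence depends only on the larger index.\<close>

lemma energy_r:
  assumes "j \<le> k" "k \<le> card nodes"
  shows "energy (r j) (r k) = energy (r k) (r k)" "energy (r k) (r j) = energy (r k) (r k)"
  using energy_residual[OF residual_r[OF assms(2)], of "r j"] residual_r[of j] assms
  by (auto simp: residual_def energy_commute)

lemma energy_r_antimono:
  assumes "j \<le> k" "k \<le> card nodes"
  shows "energy (r k) (r k) \<le> energy (r j) (r j)"
  using energy_residual_pythagoras[OF residual_r[OF assms(2)], of "r j"] residual_r[of j] assms
    energy_nonneg[of "r j - r k"] by (auto simp: residual_def)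

text \<open>Expanding the square, it suffices that the inner product of \<open>interp s\<close> and
  \<open>interp t\<close> is at least the energy of \<open>interp t\<close>. Both follow explicitly
  from the Gram matrix of the integer steps.\<close>

lemma energy_interp_diff:
  assumes "0 \<le> s" "s \<le> t" "t \<le> real (card nodes)"
  shows "energy (interp s - interp t) (interp s - interp t) \<le>
    energy (interp s) (interp s) - energy (interp t) (interp t)"
proof (cases "t = 0")
  case True
  then show ?thesis using assms by (simp add: energy_def)
next
  case False
  then have "0 < t" using assms by simp
  then obtain k where k: "real k < t" "t \<le> real (Suc k)" "k < card nodes"
    using assms piece by metis
  define \<alpha> where "\<alpha> = t - real k"
  have \<alpha>: "0 \<le> \<alpha>" "\<alpha> \<le> 1" using k by (auto simp: \<alpha>_def)
  have it: "interp t = Polynomial.smult (1 - \<alpha>) (r k) + Polynomial.smult \<alpha> (r (Suc k))"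
    using interp_on_piece[of k t] k by (simp add: \<alpha>_def)
  define a b where "a = energy (r k) (r k)" and "b = energy (r (Suc k)) (r (Suc k))"
  have ab: "b \<le> a" unfolding a_def b_def using k by (intro energy_r_antimono) auto
  have ek: "energy (r k) (r k) = a" "energy (r k) (r (Suc k)) = b" "energy (r (Suc k)) (r k) = b"
    "energy (r (Suc k)) (r (Suc k)) = b"
    using energy_r[of k "Suc k"] k by (auto simp: a_def b_def)
  have tt: "energy (interp t) (interp t) = b + (1 - \<alpha>) * (1 - \<alpha>) * (a - b)"
    by (simp add: it energy_add energy_smult ek) (simp add: algebra_simps)
  \<comment> \<open>On the same piece \<beta> is the fractional position of \<open>s\<close>. For
    \<open>s\<close> on an earlier piece \<beta> is 0, as if \<open>s\<close> were at the left
    endpoint of the piece of \<open>t\<close>.\<close>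
  have "\<exists>\<beta>. \<beta> \<le> \<alpha> \<and> energy (interp s) (interp t) = b + (1 - \<alpha>) * (1 - \<beta>) * (a - b)"
  proof (cases "real k \<le> s")
    case True
    have ips: "interp s = Polynomial.smult (1 - (s - real k)) (r k) + Polynomial.smult (s - real k) (r (Suc k))"
      using interp_on_piece[of k s] True assms k by simp
    show ?thesis
      using assms
      by (intro exI[of _ "s - real k"])
        (simp add: it ips energy_add energy_smult ek, simp add: \<alpha>_def algebra_simps)
  next
    case False
    define j where "j = nat \<lfloor>s\<rfloor>"
    have "real j = real_of_int \<lfloor>s\<rfloor>" using assms by (simp add: j_def)
    then have j: "real j \<le> s" "s \<le> real (Suc j)" by linarith+
    then have "real j < real k" using False by simp
    then have jk: "j < k" by simp
    define \<gamma> where "\<gamma> = s - real j"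
    have ips: "interp s = Polynomial.smult (1 - \<gamma>) (r j) + Polynomial.smult \<gamma> (r (Suc j))"
      using interp_on_piece[of j s] j by (simp add: \<gamma>_def)
    have ej: "energy (r j) (r k) = a" "energy (r (Suc j)) (r k) = a"
      "energy (r j) (r (Suc k)) = b" "energy (r (Suc j)) (r (Suc k)) = b"
      using energy_r[of j k] energy_r[of "Suc j" k] energy_r[of j "Suc k"] energy_r[of "Suc j" "Suc k"] jk k
      by (auto simp: a_def b_def)
    show ?thesis
      using \<alpha> by (intro exI[of _ 0])
        (simp add: it ips energy_add energy_smult ej, simp add: algebra_simps)
  qed
  then obtain \<beta> where \<beta>: "\<beta> \<le> \<alpha>" "energy (interp s) (interp t) = b + (1 - \<alpha>) * (1 - \<beta>) * (a - b)" by blast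
  have "(1 - \<alpha>) * (1 - \<alpha>) * (a - b) \<le> (1 - \<alpha>) * (1 - \<beta>) * (a - b)"
    using \<alpha> \<beta>(1) ab by (intro mult_right_mono mult_left_mono) auto
  then have "energy (interp t) (interp t) \<le> energy (interp s) (interp t)" using tt \<beta>(2) by simp
  then show ?thesis by (simp add: energy_diff energy_commute[of "interp t" "interp s"])
qed

text \<open>In degree \<open>card nodes\<close> the polynomial with all nodes as roots competes, so
  the minimal energy is 0.\<close>

lemma interp_final:
  assumes "i < D"
  shows "poly (interp (real (card nodes))) (x i) = 0"
proof -
  define n where "n = card nodes"
  have fin: "nodes \<subseteq> {0<..}" "finite nodes" using x_pos by auto
  have "0 < n" using assms by (auto simp: n_def card_gt_0_iff)
  then obtain m where m: "n = Suc m" using gr0_implies_Suc by blast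
  have "interp (real n) = r n" using interp_on_piece[of m "real n"] m by simp
  moreover have "energy (r n) (r n) = 0"
  proof -
    define q where "q = (\<Prod>z\<in>nodes. [:1, - (1 / z):])"
    have "poly q a = 0" if "a \<in> nodes" for a
    proof -
      have "1 - a / a = 0" using that fin by (cases "a = 0") auto
      then show ?thesis
        unfolding q_def poly_prod using that fin by (intro prod_zero bexI[of _ a]) auto
    qed
    then have "energy q q = 0" by (simp add: energy_def)
    moreover have "degree q \<le> n" "poly q 0 = 1"
      using degree_prod_linear[OF fin(2,1)] by (auto simp: q_def n_def poly_prod)
    ultimately show ?thesis
      using energy_residual_pythagoras[of n "r n" q] residual_r[of n] energy_nonneg[of "r n"]
        energy_nonneg[of "q - r n"] by (simp add: n_def)
  qed
  ultimately show ?thesis using energy_self_eq_0 assms by (simp add: n_def)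
qed

end

section \<open>Pathwise comparison of the stopping rule with the balanced oracle\<close>

locale noisy_residuals = interpolated_residuals D x c r
  for D :: nat and x c :: "nat \<Rightarrow> real" and r :: "nat \<Rightarrow> real poly" +
  fixes g e :: "nat \<Rightarrow> real"
  assumes c_eq: "i < D \<Longrightarrow> c i = g i + e i"
    and x_antimono: "i \<le> j \<Longrightarrow> j < D \<Longrightarrow> x j \<le> x i"
begin

definition res :: "real \<Rightarrow> real" where
  "res t = (\<Sum>i<D. (poly (interp t) (x i) * (g i + e i))\<^sup>2)"

definition stoch :: "real \<Rightarrow> real" where
  "stoch t = (\<Sum>i<D. (1 - cut t (x i)) * (e i)\<^sup>2)"

definition approx :: "real \<Rightarrow> real" where
  "approx t = (\<Sum>i<D. cut t (x i) * (g i)\<^sup>2) + res t - (\<Sum>i<D. cut t (x i) * (g i + e i)\<^sup>2)"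

definition loss :: "real \<Rightarrow> real" where
  "loss t = (\<Sum>i<D. (e i - poly (interp t) (x i) * (g i + e i))\<^sup>2)"

lemma res_energy: "res t = energy (interp t) (interp t)"
  unfolding res_def energy_def using c_eq by (intro sum.cong) (auto simp: power2_eq_square)

theorem loss_stopped_le:
  assumes \<kappa>: "0 < \<kappa>" and M: "0 \<le> M"
    "\<And>m. m < D \<Longrightarrow> \<bar>\<Sum>i\<in>{m..<D}. g i * e i\<bar> - (\<Sum>i\<in>{m..<D}. (g i)\<^sup>2) \<le> M"
  defines "d \<equiv> real (card nodes)"
  defines "\<tau> \<equiv> Inf {t \<in> {0..d}. res t \<le> \<kappa>}" and "\<tau>b \<equiv> Inf {t \<in> {0..d}. approx t \<le> stoch t}"
  shows "\<tau> \<in> {0..d}" "\<tau>b \<in> {0..d}"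
    "loss \<tau> \<le> 300 * stoch \<tau>b + (4 * M + 2 * \<bar>\<kappa> - (\<Sum>i<D. (e i)\<^sup>2)\<bar>)"
proof -
  have d: "0 \<le> d" by (simp add: d_def)
  have cont_res: "continuous_on {0..d} res"
    unfolding res_def d_def by (intro continuous_intros continuous_on_interp)
  have res_d: "res d = 0" by (simp add: res_def d_def interp_final)
  note \<tau> = first_passage[OF cont_res d, of \<kappa>, folded \<tau>_def]
  have \<tau>_in: "\<tau> \<in> {0..d}" and \<tau>_res: "res \<tau> \<le> \<kappa>" "\<tau> = 0 \<or> res \<tau> = \<kappa>"
    using \<tau> res_d \<kappa> by auto
  have x_nonneg: "0 \<le> x i" if "i < D" for i using x_pos[OF that] by simp
  have cont_diff: "continuous_on {0..d} (\<lambda>t. approx t - stoch t)"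
    unfolding approx_def stoch_def d_def
    using cont_res[unfolded d_def] x_nonneg by (intro continuous_intros continuous_on_cut) auto
  have cut_d: "cut d (x i) = 0" if "i < D" for i
    using cut_cases[of d "x i"] d x_nonneg that by (auto simp: d_def interp_final)
  \<comment> \<open>At the final time residual and truncation vanish on the spectrum, so the
    balancing inequality holds there and the set defining the oracle is nonempty.\<close>
  have "approx d = 0" by (simp add: approx_def res_d cut_d)
  moreover have "0 \<le> stoch d" by (simp add: stoch_def cut_d sum_nonneg)
  ultimately have "approx d - stoch d \<le> 0" by simp
  from first_passage[OF cont_diff d this] have \<tau>b_in: "\<tau>b \<in> {0..d}" and bal: "approx \<tau>b \<le> stoch \<tau>b"
    by (auto simp: \<tau>b_def)
  interpret balanced_errors D g e "\<lambda>i. poly (interp \<tau>b) (x i)" "\<lambda>i. cut \<tau>b (x i)" "stoch \<tau>b" "approx \<tau>b" "loss \<tau>b"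
  proof
    fix i assume "i < D"
    then show "0 \<le> cut \<tau>b (x i)" "cut \<tau>b (x i) \<le> 1"
        "cut \<tau>b (x i) = poly (interp \<tau>b) (x i) \<or> cut \<tau>b (x i) = 0"
      using \<tau>b_in x_nonneg cut_bounds[of \<tau>b "x i"] cut_cases[of \<tau>b "x i"] by (auto simp: d_def)
  qed (simp_all add: stoch_def approx_def res_def loss_def bal[unfolded stoch_def approx_def res_def])
  have close: "\<bar>res \<tau>b - (\<Sum>i<D. (e i)\<^sup>2)\<bar> \<le> 138 * stoch \<tau>b + 2 * M"
    unfolding res_def using x_antimono x_nonneg M
    by (intro residual_norm_close cut_antimono) auto
  \<comment> \<open>The constant is 300 = 2 * 12 + 2 * 138, from the loss at the oracle and the
    distance of the two estimators.\<close>
  have sum_bound: "a \<le> 2 * b + 2 * q \<Longrightarrow> q \<le> k + 138 * s + 2 * M \<Longrightarrow> b \<le> 12 * s \<Longrightarrow>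
      a \<le> 300 * s + (4 * M + 2 * k)" for a b q k s :: real
    by linarith
  let ?q = "interp \<tau>b - interp \<tau>"
  have "energy ?q ?q \<le> \<bar>res \<tau> - res \<tau>b\<bar>"
  proof (cases "\<tau> \<le> \<tau>b")
    case True
    then show ?thesis
      using energy_interp_diff[of \<tau> \<tau>b] \<tau>_in \<tau>b_in
      by (simp add: d_def res_energy energy_diff)
  next
    case False
    then show ?thesis
      using energy_interp_diff[of \<tau>b \<tau>] \<tau>_in \<tau>b_in by (simp add: d_def res_energy)
  qed
  \<comment> \<open>Only stopping at time 0 can leave the residual below \<kappa>. It is then the
    largest residual, so that of the oracle lies below it and even further from \<kappa>.\<close>
  also have "\<dots> \<le> \<bar>\<kappa> - res \<tau>b\<bar>"
  proof (cases "res \<tau> = \<kappa>")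
    case False
    then have "\<tau> = 0" using \<tau>_res by auto
    then have "res \<tau>b \<le> res \<tau>"
      using energy_interp_diff[of 0 \<tau>b] energy_nonneg[of "interp 0 - interp \<tau>b"] \<tau>b_in
      by (simp add: d_def res_energy)
    then show ?thesis using \<tau>_res by simp
  qed simp
  finally have step: "energy ?q ?q \<le> \<bar>\<kappa> - (\<Sum>i<D. (e i)\<^sup>2)\<bar> + 138 * stoch \<tau>b + 2 * M"
    using close by linarith
  have "loss \<tau> \<le> (\<Sum>i<D. 2 * (e i - poly (interp \<tau>b) (x i) * (g i + e i))\<^sup>2
      + 2 * ((c i)\<^sup>2 * poly ?q (x i) * poly ?q (x i)))"
    unfolding loss_def
  proof (rule sum_mono)
    fix i assume "i \<in> {..<D}"
    then have c: "c i = g i + e i" using c_eq by simp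
    have sq: "(a + b)\<^sup>2 \<le> 2 * a\<^sup>2 + 2 * b\<^sup>2" for a b :: real
      using sum_squares_bound[of a b] by (simp add: power2_sum)
    have "e i - poly (interp \<tau>) (x i) * (g i + e i) =
        (e i - poly (interp \<tau>b) (x i) * (g i + e i)) + c i * poly ?q (x i)"
      by (simp add: c algebra_simps)
    then have "(e i - poly (interp \<tau>) (x i) * (g i + e i))\<^sup>2 \<le>
        2 * (e i - poly (interp \<tau>b) (x i) * (g i + e i))\<^sup>2 + 2 * (c i * poly ?q (x i))\<^sup>2"
      by (simp only: sq)
    then show "(e i - poly (interp \<tau>) (x i) * (g i + e i))\<^sup>2 \<le>
        2 * (e i - poly (interp \<tau>b) (x i) * (g i + e i))\<^sup>2 + 2 * ((c i)\<^sup>2 * poly ?q (x i) * poly ?q (x i))"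
      by (simp only: power_mult_distrib power2_eq_square[of "poly ?q (x i)"] mult.assoc)
  qed
  also have "\<dots> = 2 * loss \<tau>b + 2 * energy ?q ?q"
    by (simp only: loss_def energy_def sum.distrib sum_distrib_left)
  finally show "loss \<tau> \<le> 300 * stoch \<tau>b + (4 * M + 2 * \<bar>\<kappa> - (\<Sum>i<D. (e i)\<^sup>2)\<bar>)"
    using step loss_le sum_bound by blast
  show "\<tau> \<in> {0..d}" "\<tau>b \<in> {0..d}" by fact+
qed

end

subsection \<open>Spectral coordinates\<close>

locale svd_system =
  fixes D P :: nat and A :: "real mat" and sv :: "nat \<Rightarrow> real" and u v :: "nat \<Rightarrow> real vec"
  assumes A_carrier: "A \<in> carrier_mat D P" and singular: "singular_system D P A sv u v"
begin

lemma u_carrier: "i < D \<Longrightarrow> u i \<in> carrier_vec D"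
  and v_carrier: "i < D \<Longrightarrow> v i \<in> carrier_vec P"
  and sv_pos: "i < D \<Longrightarrow> 0 < sv i"
  and sv_antimono: "i \<le> j \<Longrightarrow> j < D \<Longrightarrow> sv j \<le> sv i"
  and A_v: "i < D \<Longrightarrow> A *\<^sub>v v i = sv i \<cdot>\<^sub>v u i"
  and At_u: "i < D \<Longrightarrow> transpose_mat A *\<^sub>v u i = sv i \<cdot>\<^sub>v v i"
  and u_orthonormal: "i < D \<Longrightarrow> j < D \<Longrightarrow> u i \<bullet> u j = (if i = j then 1 else 0)"
  using singular by (auto simp: singular_system_def orthonormal_family_def)

lemma u_dim: "i < D \<Longrightarrow> dim_vec (u i) = D"
  using u_carrier by auto

text \<open>Orthonormal columns give a left inverse, and for a square matrix this is also a right
  inverse.\<close>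

lemma sum_u_u:
  assumes "l < D" "m < D"
  shows "(\<Sum>i<D. u i $ l * u i $ m) = (if l = m then 1 else 0)"
proof -
  define U where "U = mat D D (\<lambda>(l, i). u i $ l)"
  have U: "U \<in> carrier_mat D D" by (simp add: U_def)
  have "transpose_mat U * U = 1\<^sub>m D"
  proof (rule eq_matI)
    fix i j assume "i < dim_row (1\<^sub>m D :: real mat)" "j < dim_col (1\<^sub>m D :: real mat)"
    then have ij: "i < D" "j < D" by auto
    have "col U k = u k" if "k < D" for k
      using that u_carrier[OF that] by (auto simp: U_def)
    then show "(transpose_mat U * U) $$ (i, j) = 1\<^sub>m D $$ (i, j)"
      using ij U u_orthonormal by simp
  qed (use U in auto)
  then have "U * transpose_mat U = 1\<^sub>m D"
    using mat_mult_left_right_inverse[of "transpose_mat U" D U] U by simp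
  then have "(U * transpose_mat U) $$ (l, m) = (if l = m then 1 else 0)" using assms by simp
  then show ?thesis
    using assms by (simp add: U_def scalar_prod_def atLeast0LessThan)
qed

lemma expand:
  assumes w: "w \<in> carrier_vec D" and l: "l < D"
  shows "(\<Sum>i<D. (w \<bullet> u i) * u i $ l) = w $ l"
proof -
  have "(\<Sum>i<D. (w \<bullet> u i) * u i $ l) = (\<Sum>i<D. \<Sum>m<D. w $ m * (u i $ l * u i $ m))"
    by (intro sum.cong refl) (auto simp: scalar_prod_def atLeast0LessThan sum_distrib_left u_dim mult_ac)
  also have "\<dots> = (\<Sum>m<D. w $ m * (\<Sum>i<D. u i $ l * u i $ m))"
    by (subst sum.swap) (simp add: sum_distrib_left)
  also have "\<dots> = (\<Sum>m<D. if l = m then w $ m else 0)"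
    using l by (intro sum.cong refl) (simp add: sum_u_u)
  also have "\<dots> = w $ l" using l by simp
  finally show ?thesis .
qed

lemma parseval:
  assumes w: "w \<in> carrier_vec D"
  shows "w \<bullet> w = (\<Sum>i<D. (w \<bullet> u i)\<^sup>2)"
proof -
  have "w \<bullet> w = (\<Sum>l<D. w $ l * (\<Sum>i<D. (w \<bullet> u i) * u i $ l))"
    using w by (simp add: scalar_prod_def[of w w] atLeast0LessThan expand)
  also have "\<dots> = (\<Sum>i<D. (w \<bullet> u i) * (\<Sum>l<D. w $ l * u i $ l))"
    unfolding sum_distrib_left by (subst sum.swap) (simp add: mult_ac)
  also have "\<dots> = (\<Sum>i<D. (w \<bullet> u i)\<^sup>2)"
  proof (intro sum.cong refl)
    fix i assume "i \<in> {..<D}"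
    then have "dim_vec (u i) = D" using u_carrier[of i] by simp
    then show "(w \<bullet> u i) * (\<Sum>l<D. w $ l * u i $ l) = (w \<bullet> u i)\<^sup>2"
      by (simp add: scalar_prod_def atLeast0LessThan power2_eq_square)
  qed
  finally show ?thesis .
qed

lemma euclid_norm_sq:
  assumes "w \<in> carrier_vec D"
  shows "(euclid_norm w)\<^sup>2 = (\<Sum>i<D. (w \<bullet> u i)\<^sup>2)"
  using parseval[OF assms] by (simp add: euclid_norm_def sum_nonneg)

lemma spec_fun_carrier: "spec_fun D sv u h w \<in> carrier_vec D"
  by (simp add: spec_fun_def)

lemma spec_fun_coord:
  assumes j: "j < D"
  shows "spec_fun D sv u h w \<bullet> u j = h ((sv j)\<^sup>2) * (w \<bullet> u j)"
proof -
  have dim: "dim_vec (u i) = D" if "i < D" for i using u_carrier[OF that] by simp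
  have "spec_fun D sv u h w \<bullet> u j = (\<Sum>l<D. \<Sum>i<D. h ((sv i)\<^sup>2) * (w \<bullet> u i) * (u i $ l * u j $ l))"
    unfolding scalar_prod_def[of "spec_fun D sv u h w"] dim[OF j] atLeast0LessThan
    by (intro sum.cong refl) (simp add: spec_fun_def sum_distrib_right mult.assoc)
  also have "\<dots> = (\<Sum>i<D. h ((sv i)\<^sup>2) * (w \<bullet> u i) * (\<Sum>l<D. u i $ l * u j $ l))"
    by (subst sum.swap) (simp add: sum_distrib_left)
  also have "\<dots> = (\<Sum>i<D. h ((sv i)\<^sup>2) * (w \<bullet> u i) * (if i = j then 1 else 0))"
  proof (intro sum.cong refl)
    fix i assume "i \<in> {..<D}"
    then have "(\<Sum>l<D. u i $ l * u j $ l) = (if i = j then 1 else 0)"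
      using u_orthonormal[of i j] j dim[OF j] by (simp add: scalar_prod_def atLeast0LessThan)
    then show "h ((sv i)\<^sup>2) * (w \<bullet> u i) * (\<Sum>l<D. u i $ l * u j $ l) =
        h ((sv i)\<^sup>2) * (w \<bullet> u i) * (if i = j then 1 else 0)" by simp
  qed
  also have "\<dots> = h ((sv j)\<^sup>2) * (w \<bullet> u j)" using j by (simp add: if_distrib cong: if_cong)
  finally show ?thesis .
qed

lemma spec_fun_norm: "(euclid_norm (spec_fun D sv u h w))\<^sup>2 = (\<Sum>i<D. (h ((sv i)\<^sup>2) * (w \<bullet> u i))\<^sup>2)"
  by (simp add: euclid_norm_sq[OF spec_fun_carrier] spec_fun_coord)

lemma A_pinv:
  assumes w: "w \<in> carrier_vec D"
  shows "A *\<^sub>v (pinv A *\<^sub>v w) = w" and "pinv A *\<^sub>v w \<in> carrier_vec P"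
proof -
  define B where "B = A * transpose_mat A"
  have At: "transpose_mat A \<in> carrier_mat P D" using A_carrier by simp
  have B: "B \<in> carrier_mat D D" using A_carrier by (auto simp: B_def)
  have Bt: "transpose_mat B = B"
    unfolding B_def using A_carrier At by (subst transpose_mult[of _ D P _ D]) auto
  have Bu: "B *\<^sub>v u i = (sv i)\<^sup>2 \<cdot>\<^sub>v u i" if "i < D" for i
  proof -
    have "B *\<^sub>v u i = A *\<^sub>v (sv i \<cdot>\<^sub>v v i)"
      unfolding B_def using assoc_mult_mat_vec[OF A_carrier At u_carrier[OF that]] At_u[OF that] by simp
    also have "\<dots> = sv i \<cdot>\<^sub>v (sv i \<cdot>\<^sub>v u i)"
      using mult_mat_vec[OF A_carrier v_carrier[OF that], of "sv i"] A_v[OF that] by simp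
    finally show ?thesis by (simp add: smult_smult_assoc power2_eq_square)
  qed
  \<comment> \<open>A kernel vector would be orthogonal to every \<open>u i\<close>, since
    \<open>B\<close> is symmetric with nonzero eigenvalues there, and hence zero. Thus
    \<open>mat_inverse\<close> returns a genuine inverse.\<close>
  have "det B \<noteq> 0"
  proof
    assume "det B = 0"
    then obtain y where y: "y \<in> carrier_vec D" "y \<noteq> 0\<^sub>v D" "B *\<^sub>v y = 0\<^sub>v D"
      using det_0_iff_vec_prod_zero[OF B] by blast
    have "y \<bullet> u i = 0" if "i < D" for i
    proof -
      have "(B *\<^sub>v y) \<bullet> u i = y \<bullet> (B *\<^sub>v u i)"
        using transpose_vec_mult_scalar[OF B u_carrier[OF that] y(1)] unfolding Bt .
      then have "0 = (sv i)\<^sup>2 * (y \<bullet> u i)"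
        using y u_carrier[OF that] by (simp add: Bu[OF that])
      then show ?thesis using sv_pos[OF that] by simp
    qed
    then have "y = 0\<^sub>v D"
      using y(1) expand[OF y(1)] by (intro eq_vecI) auto
    then show False using y by simp
  qed
  then have "B \<in> Units (ring_mat TYPE(real) D ())" by (rule det_non_zero_imp_unit[OF B])
  then obtain C where C: "mat_inverse B = Some C"
    using mat_inverse(1)[OF B, where b = "()"] by (cases "mat_inverse B") auto
  then have BC: "B * C = 1\<^sub>m D" "C \<in> carrier_mat D D" using mat_inverse(2)[OF B] by auto
  have pinv: "pinv A = transpose_mat A * C" using C by (simp add: pinv_def B_def)
  then have pc: "pinv A \<in> carrier_mat P D" using At BC by simp
  then show "pinv A *\<^sub>v w \<in> carrier_vec P" using w by simp
  have "A *\<^sub>v (pinv A *\<^sub>v w) = (A * pinv A) *\<^sub>v w"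
    using assoc_mult_mat_vec[OF A_carrier pc w] by simp
  also have "A * pinv A = B * C"
    unfolding pinv B_def using assoc_mult_mat[OF A_carrier At BC(2)] by simp
  finally show "A *\<^sub>v (pinv A *\<^sub>v w) = w" using BC w by simp
qed

end

section \<open>The observation model in spectral coordinates\<close>

locale observed_signal = svd_system +
  fixes f \<xi> :: "real vec"
  assumes f_carrier: "f \<in> carrier_vec P" and \<xi>_carrier: "\<xi> \<in> carrier_vec D"
    and Y_nz: "i < D \<Longrightarrow> (A *\<^sub>v f + \<xi>) \<bullet> u i \<noteq> 0"
begin

abbreviation "g \<equiv> A *\<^sub>v f"
abbreviation "Y \<equiv> g + \<xi>"

lemma g_carrier: "g \<in> carrier_vec D" and Y_carrier: "Y \<in> carrier_vec D"
  using A_carrier f_carrier \<xi>_carrier by auto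

lemma Y_coord: "i < D \<Longrightarrow> Y \<bullet> u i = g \<bullet> u i + \<xi> \<bullet> u i"
  using add_scalar_prod_distrib[OF g_carrier \<xi>_carrier u_carrier] .

sublocale krylov D "\<lambda>i. (sv i)\<^sup>2" "\<lambda>i. Y \<bullet> u i"
proof
  fix i assume "i < D"
  then show "0 < (sv i)\<^sup>2" "Y \<bullet> u i \<noteq> 0" using sv_pos[of i] Y_nz[of i] by auto
qed

lemma card_nodes: "card nodes = num_distinct_sv D sv"
proof -
  have "inj_on (\<lambda>y::real. y\<^sup>2) (sv ` {..<D})"
    using sv_pos by (auto intro!: inj_onI simp: power2_eq_iff) (metis add.inverse_inverse less_asym neg_0_less_iff_less)+
  then have "card ((\<lambda>y. y\<^sup>2) ` (sv ` {..<D})) = card (sv ` {..<D})" by (rule card_image)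
  then show ?thesis by (simp add: num_distinct_sv_def image_image)
qed

lemma energy_spec_fun: "(euclid_norm (spec_fun D sv u (poly q) Y))\<^sup>2 = energy q q"
  unfolding spec_fun_norm energy_def
  by (intro sum.cong refl) (simp add: power2_eq_square[of "_ * _"] power2_eq_square[of "Y \<bullet> _"] mult_ac)

text \<open>The orthogonal polynomial exists, minimises by Pythagoras and is the only minimiser, so
  the definite description in \<open>cg_poly\<close> denotes it.\<close>

lemma residual_cg_poly:
  assumes "k \<le> card nodes"
  shows "residual k (cg_poly D sv u Y k)"
proof -
  obtain p where p: "residual k p" using ex_residual[OF assms] by blast
  have le: "energy p p \<le> energy q q" if "degree q \<le> k" "poly q 0 = 1" for q
    using energy_residual_pythagoras[OF p that] energy_nonneg[of "q - p"] by simp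
  have p': "degree p \<le> k" "poly p 0 = 1" using p by (auto simp: residual_def)
  have "cg_poly D sv u Y k = p"
    unfolding cg_poly_def energy_spec_fun
  proof (rule the_equality)
    show "is_arg_min (\<lambda>q. energy q q) (\<lambda>q. degree q \<le> k \<and> poly q 0 = 1) p"
      using p' le by (auto simp: is_arg_min_def not_less)
    fix q assume "is_arg_min (\<lambda>q. energy q q) (\<lambda>q. degree q \<le> k \<and> poly q 0 = 1) q"
    then have "degree q \<le> k" "poly q 0 = 1" "energy q q \<le> energy p p"
      using p' by (auto simp: is_arg_min_def not_less)
    then show "q = p" using residual_unique[OF p] assms by blast
  qed
  then show ?thesis using p by simp
qed

sublocale noisy_residuals D "\<lambda>i. (sv i)\<^sup>2" "\<lambda>i. Y \<bullet> u i" "cg_poly D sv u Y" "\<lambda>i. g \<bullet> u i" "\<lambda>i. \<xi> \<bullet> u i"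
proof
  fix i j :: nat assume "i \<le> j" "j < D"
  then show "(sv j)\<^sup>2 \<le> (sv i)\<^sup>2"
    using sv_antimono[of i j] sv_pos[of j] by (intro power_mono) auto
qed (use residual_cg_poly Y_coord in auto)

lemma cg_interp_eq: "cg_interp D sv u Y t = interp t"
  by (simp add: cg_interp_def interp_def)

lemma A_estimator:
  shows "cg_estimator D A sv u Y t \<in> carrier_vec P"
    and "A *\<^sub>v cg_estimator D A sv u Y t = Y - spec_fun D sv u (poly (interp t)) Y"
  using A_pinv[of "Y - spec_fun D sv u (poly (interp t)) Y"] Y_carrier
  by (auto simp: cg_estimator_def cg_interp_eq spec_fun_def)

lemma cg_res_eq: "cg_res D A sv u Y t = res t"
proof -
  let ?w = "Y - spec_fun D sv u (poly (interp t)) Y"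
  have w: "?w - Y \<in> carrier_vec D" using Y_carrier by (simp add: spec_fun_def)
  have "(?w - Y) \<bullet> u i = - (poly (interp t) ((sv i)\<^sup>2) * (Y \<bullet> u i))" if "i < D" for i
    using Y_carrier u_carrier[OF that] spec_fun_carrier
    by (simp add: minus_scalar_prod_distrib[of _ D] spec_fun_coord[OF that])
  then show ?thesis
    unfolding cg_res_def A_estimator(2) euclid_norm_sq[OF w] res_def
    by (intro sum.cong refl) (simp add: Y_coord)
qed

lemma loss_eq: "(euclid_norm (A *\<^sub>v (cg_estimator D A sv u Y t - f)))\<^sup>2 = loss t"
proof -
  let ?w = "Y - spec_fun D sv u (poly (interp t)) Y"
  have eq: "A *\<^sub>v (cg_estimator D A sv u Y t - f) = ?w - g"
    using mult_minus_distrib_mat_vec[OF A_carrier A_estimator(1) f_carrier] A_estimator(2) by simp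
  have w: "?w - g \<in> carrier_vec D" using Y_carrier g_carrier by (simp add: spec_fun_def)
  have "(?w - g) \<bullet> u i = \<xi> \<bullet> u i - poly (interp t) ((sv i)\<^sup>2) * (Y \<bullet> u i)" if "i < D" for i
    using Y_carrier g_carrier u_carrier[OF that] spec_fun_carrier
    by (simp add: minus_scalar_prod_distrib[of _ D] spec_fun_coord[OF that] Y_coord[OF that])
  then show ?thesis
    unfolding eq euclid_norm_sq[OF w] loss_def by (intro sum.cong refl) (simp add: Y_coord)
qed

lemma cg_trunc_eq:
  assumes "t \<in> {0..real (card nodes)}" "0 \<le> y"
  shows "cg_trunc D sv u Y t y = cut t y"
  unfolding cg_trunc_def cg_interp_eq using assms by (intro truncated_interp) auto

lemma stoch_err_eq:
  assumes "t \<in> {0..real (card nodes)}"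
  shows "stoch_err D sv u g \<xi> t = stoch t"
  unfolding stoch_err_def spec_fun_norm stoch_def
  using assms cut_bounds[of t] by (intro sum.cong refl) (simp add: cg_trunc_eq power_mult_distrib)

lemma approx_err_eq:
  assumes "t \<in> {0..real (card nodes)}"
  shows "approx_err D A sv u g \<xi> t = approx t"
proof -
  have "(\<Sum>i<D. (sqrt (cg_trunc D sv u Y t ((sv i)\<^sup>2)) * w i)\<^sup>2) = (\<Sum>i<D. cut t ((sv i)\<^sup>2) * (w i)\<^sup>2)"
    for w :: "nat \<Rightarrow> real"
    using assms cut_bounds[of t] by (intro sum.cong refl) (simp add: cg_trunc_eq power_mult_distrib)
  then show ?thesis
    unfolding approx_err_def spec_fun_norm approx_def cg_res_eq by (simp add: Y_coord)
qed

theorem prediction_error_le: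
  assumes \<kappa>: "0 < \<kappa>" and M: "0 \<le> M"
    "\<And>m. m < D \<Longrightarrow> \<bar>\<Sum>i\<in>{m..<D}. (g \<bullet> u i) * (\<xi> \<bullet> u i)\<bar> - (\<Sum>i\<in>{m..<D}. (g \<bullet> u i)\<^sup>2) \<le> M"
  shows "(euclid_norm (A *\<^sub>v (cg_estimator D A sv u Y (stopping_time D A sv u \<kappa> Y) - f)))\<^sup>2 \<le>
    300 * stoch_err D sv u g \<xi> (balanced_oracle D A sv u g \<xi>) + (4 * M + 2 * \<bar>\<kappa> - \<xi> \<bullet> \<xi>\<bar>)"
proof -
  have st: "stopping_time D A sv u \<kappa> Y = Inf {t \<in> {0..real (card nodes)}. res t \<le> \<kappa>}"
    by (simp add: stopping_time_def card_nodes cg_res_eq)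
  have bo: "balanced_oracle D A sv u g \<xi> = Inf {t \<in> {0..real (card nodes)}. approx t \<le> stoch t}"
    unfolding balanced_oracle_def card_nodes[symmetric]
    by (rule arg_cong[where f = Inf]) (auto simp: approx_err_eq stoch_err_eq)
  note main = loss_stopped_le[OF \<kappa> M, folded st bo]
  show ?thesis
    using main by (simp add: loss_eq stoch_err_eq parseval[OF \<xi>_carrier])
qed

end

subsection \<open>Gaussian integrals\<close>

text \<open>Subadditivity of the lower integral only needs one measurable summand.\<close>

lemma nn_integral_le_cmult_add:
  fixes F h b :: "'a \<Rightarrow> ennreal" and c :: real
  assumes le: "AE z in M. F z \<le> ennreal c * h z + b z" and b[measurable]: "b \<in> borel_measurable M"
    and c: "0 < c"
  shows "(\<integral>\<^sup>+z. F z \<partial>M) \<le> ennreal c * (\<integral>\<^sup>+z. h z \<partial>M) + (\<integral>\<^sup>+z. b z \<partial>M)"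
proof -
  have "(\<integral>\<^sup>+z. F z \<partial>M) \<le> (\<integral>\<^sup>+z. ennreal c * h z + b z \<partial>M)"
    using le by (rule nn_integral_mono_AE)
  also have "\<dots> \<le> ennreal c * (\<integral>\<^sup>+z. h z \<partial>M) + (\<integral>\<^sup>+z. b z \<partial>M)"
    unfolding nn_integral_def_finite[of M "\<lambda>z. ennreal c * h z + b z"]
  proof (safe intro!: SUP_least)
    fix s assume s: "simple_function M s" "s \<le> (\<lambda>z. ennreal c * h z + b z)" "\<forall>z. s z < Orderings.top"
    have [measurable]: "s \<in> borel_measurable M" using s(1) by (rule borel_measurable_simple_function)
    \<comment> \<open>Solving for \<open>h\<close> gives a measurable function below
      \<open>h\<close>, so its integral is bounded by the lower integral of \<open>h\<close>.
      Finiteness of \<open>s\<close> is used to subtract \<open>b\<close>.\<close>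
    define k where "k z = ennreal (1 / c) * (s z - b z)" for z
    have [measurable]: "k \<in> borel_measurable M" unfolding k_def by measurable
    have c1: "ennreal (1 / c) * ennreal c = 1" "ennreal c * ennreal (1 / c) = 1"
      using c by (simp_all flip: ennreal_mult')
    have "k z \<le> h z" for z
    proof -
      have "s z \<le> b z + ennreal c * h z" using s(2) by (simp add: le_fun_def add.commute)
      then have "s z - b z \<le> ennreal c * h z"
        using s(3)[rule_format, of z] by (auto simp: ennreal_minus_le_iff)
      then have "k z \<le> ennreal (1 / c) * (ennreal c * h z)" unfolding k_def by (rule mult_left_mono) simp
      then show ?thesis by (simp only: mult.assoc[symmetric] c1 mult_1_left)
    qed
    then have k: "(\<integral>\<^sup>+z. k z \<partial>M) \<le> (\<integral>\<^sup>+z. h z \<partial>M)" by (intro nn_integral_mono)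
    have "s z \<le> ennreal c * k z + b z" for z
    proof -
      have "ennreal c * k z = s z - b z" unfolding k_def by (simp only: mult.assoc[symmetric] c1 mult_1_left)
      moreover have "s z \<le> (s z - b z) + b z"
        by (cases "b z \<le> s z") (auto simp: diff_add_cancel_ennreal intro: add_increasing less_imp_le)
      ultimately show ?thesis by simp
    qed
    then have "(\<integral>\<^sup>+z. s z \<partial>M) \<le> (\<integral>\<^sup>+z. ennreal c * k z + b z \<partial>M)" by (intro nn_integral_mono)
    also have "\<dots> = ennreal c * (\<integral>\<^sup>+z. k z \<partial>M) + (\<integral>\<^sup>+z. b z \<partial>M)"
      by (simp add: nn_integral_add nn_integral_cmult)
    also have "\<dots> \<le> ennreal c * (\<integral>\<^sup>+z. h z \<partial>M) + (\<integral>\<^sup>+z. b z \<partial>M)"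
      using k by (intro add_mono mult_left_mono) auto
    finally show "integral\<^sup>S M s \<le> ennreal c * (\<integral>\<^sup>+z. h z \<partial>M) + (\<integral>\<^sup>+z. b z \<partial>M)"
      using nn_integral_eq_simple_integral[OF s(1)] by simp
  qed
  finally show ?thesis .
qed

abbreviation gauss1 :: "real measure" where
  "gauss1 \<equiv> density lborel (\<lambda>x. ennreal (std_normal_density x))"

lemma prob_space_gauss1: "prob_space gauss1"
  by (rule prob_space_normal_density) simp

interpretation gauss: product_sigma_finite "\<lambda>_::nat. gauss1"
  by (simp add: product_sigma_finite_def prob_space_imp_sigma_finite prob_space_gauss1)

interpretation std_gaussian: prob_space "std_gaussian D" for D
  unfolding std_gaussian_def by (intro prob_space_PiM prob_space_gauss1)

lemma sets_std_gaussian[measurable_cong]: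
  "sets (std_gaussian D) = sets (\<Pi>\<^sub>M i\<in>{..<D}. borel)"
  unfolding std_gaussian_def by (intro sets_PiM_cong) auto

text \<open>Completing the square turns the integrand into a constant times the normal density with
  mean \<open>a\<close>.\<close>

lemma gauss1_exp: "(\<integral>\<^sup>+y. ennreal (exp (a * y)) \<partial>gauss1) = ennreal (exp (a\<^sup>2 / 2))"
proof -
  have eq: "std_normal_density y * exp (a * y) = exp (a\<^sup>2 / 2) * normal_density a 1 y" for y
  proof -
    have "- y\<^sup>2 / 2 + a * y = a\<^sup>2 / 2 + - (y - a)\<^sup>2 / 2" by (simp add: power2_diff field_simps)
    then have "exp (- y\<^sup>2 / 2) * exp (a * y) = exp (a\<^sup>2 / 2) * exp (- (y - a)\<^sup>2 / 2)"
      by (simp only: exp_add[symmetric])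
    then show ?thesis by (simp add: normal_density_def)
  qed
  have "(\<integral>\<^sup>+y. ennreal (exp (a * y)) \<partial>gauss1) =
      (\<integral>\<^sup>+y. ennreal (exp (a\<^sup>2 / 2)) * ennreal (normal_density a 1 y) \<partial>lborel)"
    by (simp add: nn_integral_density ennreal_mult'[symmetric] eq)
  also have "\<dots> = ennreal (exp (a\<^sup>2 / 2)) * (\<integral>\<^sup>+y. ennreal (normal_density a 1 y) \<partial>lborel)"
    by (rule nn_integral_cmult) simp
  also have "(\<integral>\<^sup>+y. ennreal (normal_density a 1 y) \<partial>lborel) = 1"
    using prob_space.emeasure_space_1[OF prob_space_normal_density[of 1 a]]
    by (simp add: emeasure_density)
  finally show ?thesis by simp
qed

lemma gaussian_exp:
  "(\<integral>\<^sup>+z. ennreal (exp (\<Sum>l<D. w l * z l)) \<partial>std_gaussian D) = ennreal (exp ((\<Sum>l<D. (w l)\<^sup>2) / 2))"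
proof -
  have "(\<integral>\<^sup>+z. ennreal (exp (\<Sum>l<D. w l * z l)) \<partial>std_gaussian D) =
      (\<integral>\<^sup>+z. (\<Prod>l<D. ennreal (exp (w l * z l))) \<partial>std_gaussian D)"
    by (simp add: exp_sum prod_ennreal)
  also have "\<dots> = (\<Prod>l<D. (\<integral>\<^sup>+y. ennreal (exp (w l * y)) \<partial>gauss1))"
    unfolding std_gaussian_def by (rule gauss.product_nn_integral_prod) auto
  also have "\<dots> = ennreal (exp ((\<Sum>l<D. (w l)\<^sup>2) / 2))"
    by (simp add: gauss1_exp prod_ennreal exp_sum sum_divide_distrib)
  finally show ?thesis .
qed

lemma gauss1_singleton: "AE y in gauss1. y \<noteq> a"
  using AE_lborel_singleton[of a] by (subst AE_density) (auto elim: eventually_mono)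

text \<open>Integrate over coordinate \<open>j\<close> first: with the others fixed, a single value
  of it solves the equation.\<close>

lemma gaussian_hyperplane_null:
  assumes j: "j < D" "w j \<noteq> 0"
  shows "AE z in std_gaussian D. a + (\<Sum>l<D. w l * z l) \<noteq> 0"
proof -
  let ?h = "\<lambda>z. if a + (\<Sum>l<D. w l * z l) = 0 then 1 else 0 :: ennreal"
  have D: "{..<D} = insert j ({..<D} - {j})" using j by auto
  have meas: "?h \<in> borel_measurable (std_gaussian D)" by measurable
  have "(\<integral>\<^sup>+z. ?h z \<partial>std_gaussian D) =
      (\<integral>\<^sup>+z. (\<integral>\<^sup>+y. ?h (z(j := y)) \<partial>gauss1) \<partial>(\<Pi>\<^sub>M i\<in>{..<D} - {j}. gauss1))"
  proof -
    have "?h \<in> borel_measurable (Pi\<^sub>M (insert j ({..<D} - {j})) (\<lambda>_. gauss1))"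
      using meas unfolding std_gaussian_def D[symmetric] .
    from gauss.product_nn_integral_insert[OF _ _ this] show ?thesis
      unfolding std_gaussian_def D[symmetric] by simp
  qed
  also have "\<dots> = (\<integral>\<^sup>+z. 0 \<partial>(\<Pi>\<^sub>M i\<in>{..<D} - {j}. gauss1))"
  proof (rule nn_integral_cong)
    fix z :: "nat \<Rightarrow> real"
    define s where "s = a + (\<Sum>l\<in>{..<D} - {j}. w l * z l)"
    have "a + (\<Sum>l<D. w l * (z(j := y)) l) = s + w j * y" for y
      using sum.remove[of "{..<D}" j "\<lambda>l. w l * (z(j := y)) l"] j by (simp add: s_def)
    then have "(\<integral>\<^sup>+y. ?h (z(j := y)) \<partial>gauss1) = (\<integral>\<^sup>+y. (if s + w j * y = 0 then 1 else 0) \<partial>gauss1)"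
      by (simp only:)
    also have "\<dots> = (\<integral>\<^sup>+y. 0 \<partial>gauss1)"
    proof (rule nn_integral_cong_AE)
      show "AE y in gauss1. (if s + w j * y = 0 then 1 else 0) = (0 :: ennreal)"
        using gauss1_singleton[of "- s / w j"]
      proof eventually_elim
        case (elim y)
        then show ?case using j by (auto simp: field_simps add_eq_0_iff)
      qed
    qed
    finally show "(\<integral>\<^sup>+y. ?h (z(j := y)) \<partial>gauss1) = 0" by simp
  qed
  finally have "AE z in std_gaussian D. ?h z = 0"
    using nn_integral_0_iff_AE[OF meas] by simp
  then show ?thesis by (auto elim!: eventually_mono split: if_splits)
qed

text \<open>Even moments 1, 1, 3 of the standard normal law give
  \<open>(b - 1)\<^sup>2 + 2 * (b - 1) + 3\<close>.\<close>

lemma gauss1_centered_square: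
  "(\<integral>\<^sup>+y. ennreal ((b + (y\<^sup>2 - 1))\<^sup>2) \<partial>gauss1) = ennreal (b\<^sup>2 + 2)"
proof -
  have "has_bochner_integral lborel (\<lambda>y. (b - 1)\<^sup>2 * (std_normal_density y * y ^ (2 * 0))
      + 2 * (b - 1) * (std_normal_density y * y ^ (2 * 1)) + std_normal_density y * y ^ (2 * 2))
      ((b - 1)\<^sup>2 * (fact (2 * 0) / (2 ^ 0 * fact 0)) + 2 * (b - 1) * (fact (2 * 1) / (2 ^ 1 * fact 1))
        + fact (2 * 2) / (2 ^ 2 * fact 2))"
    by (intro has_bochner_integral_add has_bochner_integral_mult_right std_normal_moment_even)
  moreover have "(b - 1)\<^sup>2 * (std_normal_density y * y ^ (2 * 0))
      + 2 * (b - 1) * (std_normal_density y * y ^ (2 * 1)) + std_normal_density y * y ^ (2 * 2) =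
      std_normal_density y * (b + (y\<^sup>2 - 1))\<^sup>2" for y
    by (simp add: power2_eq_square power4_eq_xxxx algebra_simps)
  moreover have "(b - 1)\<^sup>2 * (fact (2 * 0) / (2 ^ 0 * fact 0)) + 2 * (b - 1) * (fact (2 * 1) / (2 ^ 1 * fact 1))
        + fact (2 * 2) / (2 ^ 2 * fact 2) = b\<^sup>2 + (2::real)"
    by (simp add: fact_numeral power2_eq_square algebra_simps)
  ultimately have "has_bochner_integral lborel (\<lambda>y. std_normal_density y * (b + (y\<^sup>2 - 1))\<^sup>2) (b\<^sup>2 + 2)"
    by (simp only:)
  then have "(\<integral>\<^sup>+y. ennreal (std_normal_density y * (b + (y\<^sup>2 - 1))\<^sup>2) \<partial>lborel) = ennreal (b\<^sup>2 + 2)"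
    by (intro nn_integral_eq_integral[THEN trans])
      (auto simp: has_bochner_integral_iff)
  then show ?thesis by (simp add: nn_integral_density ennreal_mult'[symmetric])
qed

text \<open>The free offset \<open>b\<close> makes the induction work: integrating out the last
  coordinate adds its variance 2 and leaves the other coordinates as offset.\<close>

lemma gaussian_norm_variance:
  "(\<integral>\<^sup>+z. ennreal ((b + (\<Sum>l<D. (z l)\<^sup>2 - 1))\<^sup>2) \<partial>std_gaussian D) = ennreal (b\<^sup>2 + 2 * real D)"
proof (induction D arbitrary: b)
  case 0
  then show ?case using std_gaussian.emeasure_space_1[of 0] by simp
next
  case (Suc D)
  let ?h = "\<lambda>z. ennreal ((b + (\<Sum>l<Suc D. (z l)\<^sup>2 - 1))\<^sup>2)"
  have D: "{..<Suc D} = insert D {..<D}" by auto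
  have "?h \<in> borel_measurable (std_gaussian (Suc D))" by measurable
  then have "?h \<in> borel_measurable (Pi\<^sub>M (insert D {..<D}) (\<lambda>_. gauss1))"
    unfolding std_gaussian_def D[symmetric] .
  from gauss.product_nn_integral_insert[OF _ _ this]
  have "(\<integral>\<^sup>+z. ?h z \<partial>std_gaussian (Suc D)) = (\<integral>\<^sup>+z. (\<integral>\<^sup>+y. ?h (z(D := y)) \<partial>gauss1) \<partial>std_gaussian D)"
    unfolding std_gaussian_def D[symmetric] by simp
  also have "\<dots> = (\<integral>\<^sup>+z. ennreal ((b + (\<Sum>l<D. (z l)\<^sup>2 - 1))\<^sup>2) + 2 \<partial>std_gaussian D)"
  proof (rule nn_integral_cong)
    fix z :: "nat \<Rightarrow> real"
    have "b + (\<Sum>l<Suc D. ((z(D := y)) l)\<^sup>2 - 1) = (b + (\<Sum>l<D. (z l)\<^sup>2 - 1)) + (y\<^sup>2 - 1)" for y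
      by simp
    then show "(\<integral>\<^sup>+y. ?h (z(D := y)) \<partial>gauss1) = ennreal ((b + (\<Sum>l<D. (z l)\<^sup>2 - 1))\<^sup>2) + 2"
      by (simp only: gauss1_centered_square) (simp add: ennreal_plus)
  qed
  also have "\<dots> = ennreal (b\<^sup>2 + 2 * real D) + 2"
    using std_gaussian.emeasure_space_1[of D] by (subst nn_integral_add) (auto simp: Suc.IH)
  also have "\<dots> = ennreal (b\<^sup>2 + 2 * real (Suc D))"
    by (simp flip: ennreal_plus ennreal_numeral add: algebra_simps)
  finally show ?case .
qed

subsection \<open>Expected prediction error\<close>

text \<open>Chosen so that summing \<open>n\<close> exponentials of mean 1 costs only \<open>sqrt n\<close> in expectation.\<close>

lemma le_sqrt_plus_exp:
  fixes a s :: real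
  assumes "0 < s"
  shows "a \<le> s + exp a / s"
proof -
  have "1 + (a - ln s) \<le> exp (a - ln s)" by (rule exp_ge_add_one_self)
  also have "exp (a - ln s) = exp a / s" using assms by (simp add: exp_diff)
  finally show ?thesis using ln_le_minus_one[OF assms] by linarith
qed

section \<open>Maximum of the drifted partial sums\<close>

context svd_system
begin

text \<open>Standard coordinates of the projection of \<open>g\<close> onto the span of
  \<open>u m\<close>, ..., \<open>u (D - 1)\<close>. They make the tail sums linear in the
  independent coordinates \<open>z l\<close>.\<close>

definition tail_vec :: "real vec \<Rightarrow> nat \<Rightarrow> nat \<Rightarrow> real" where
  "tail_vec g m l = (\<Sum>i\<in>{m..<D}. (g \<bullet> u i) * u i $ l)"

definition tail_energy :: "real vec \<Rightarrow> nat \<Rightarrow> real" where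
  "tail_energy g m = (\<Sum>i\<in>{m..<D}. (g \<bullet> u i)\<^sup>2)"

lemma tail_vec_norm: "(\<Sum>l<D. (tail_vec g m l)\<^sup>2) = tail_energy g m"
proof -
  have "(\<Sum>l<D. (tail_vec g m l)\<^sup>2) =
      (\<Sum>l<D. \<Sum>i\<in>{m..<D}. \<Sum>j\<in>{m..<D}. (g \<bullet> u i) * (g \<bullet> u j) * (u i $ l * u j $ l))"
    unfolding tail_vec_def power2_eq_square sum_product by (simp add: mult_ac)
  also have "\<dots> = (\<Sum>i\<in>{m..<D}. \<Sum>j\<in>{m..<D}. \<Sum>l<D. (g \<bullet> u i) * (g \<bullet> u j) * (u i $ l * u j $ l))"
    by (subst sum.swap) (intro sum.cong refl sum.swap)
  also have "\<dots> = (\<Sum>i\<in>{m..<D}. \<Sum>j\<in>{m..<D}. if i = j then (g \<bullet> u i)\<^sup>2 else 0)"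
  proof (intro sum.cong refl)
    fix i j assume "i \<in> {m..<D}" "j \<in> {m..<D}"
    then have "(\<Sum>l<D. u i $ l * u j $ l) = (if i = j then 1 else 0)"
      using u_orthonormal[of i j] by (simp add: scalar_prod_def atLeast0LessThan u_dim)
    then show "(\<Sum>l<D. (g \<bullet> u i) * (g \<bullet> u j) * (u i $ l * u j $ l)) = (if i = j then (g \<bullet> u i)\<^sup>2 else 0)"
      by (simp add: sum_distrib_left[symmetric] power2_eq_square)
  qed
  also have "\<dots> = tail_energy g m" by (simp add: tail_energy_def)
  finally show ?thesis .
qed

lemma noise_coord: "i < D \<Longrightarrow> (\<delta> \<cdot>\<^sub>v vec D z) \<bullet> u i = \<delta> * (\<Sum>l<D. u i $ l * z l)"
  by (simp add: scalar_prod_def atLeast0LessThan u_dim sum_distrib_left mult_ac)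

lemma tail_noise:
  "(\<Sum>i\<in>{m..<D}. (g \<bullet> u i) * ((\<delta> \<cdot>\<^sub>v vec D z) \<bullet> u i)) = \<delta> * (\<Sum>l<D. tail_vec g m l * z l)"
proof -
  have "(\<Sum>i\<in>{m..<D}. (g \<bullet> u i) * ((\<delta> \<cdot>\<^sub>v vec D z) \<bullet> u i)) =
      (\<Sum>i\<in>{m..<D}. \<Sum>l<D. \<delta> * ((g \<bullet> u i) * u i $ l * z l))"
    by (intro sum.cong refl) (simp add: noise_coord sum_distrib_left mult_ac)
  also have "\<dots> = \<delta> * (\<Sum>l<D. tail_vec g m l * z l)"
    by (subst sum.swap) (simp add: tail_vec_def sum_distrib_left sum_distrib_right mult_ac)
  finally show ?thesis .
qed

text \<open>Exponential of a Gaussian linear form divided by its Laplace transform, hence of mean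
  1.\<close>

definition tail_exp :: "real \<Rightarrow> real vec \<Rightarrow> nat \<Rightarrow> (nat \<Rightarrow> real) \<Rightarrow> real" where
  "tail_exp a g m z = exp (\<Sum>l<D. a * tail_vec g m l * z l) * exp (- (a\<^sup>2 / 2) * tail_energy g m)"

lemma tail_exp_mean: "(\<integral>\<^sup>+z. ennreal (tail_exp a g m z) \<partial>std_gaussian D) = 1"
proof -
  have "(\<integral>\<^sup>+z. ennreal (tail_exp a g m z) \<partial>std_gaussian D) =
      (\<integral>\<^sup>+z. ennreal (exp (\<Sum>l<D. a * tail_vec g m l * z l)) \<partial>std_gaussian D) *
      ennreal (exp (- (a\<^sup>2 / 2) * tail_energy g m))"
    unfolding tail_exp_def by (simp add: ennreal_mult nn_integral_multc)
  also have "\<dots> = ennreal (exp ((\<Sum>l<D. (a * tail_vec g m l)\<^sup>2) / 2) * exp (- (a\<^sup>2 / 2) * tail_energy g m))"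
    by (simp only: gaussian_exp) (simp add: ennreal_mult)
  also have "(\<Sum>l<D. (a * tail_vec g m l)\<^sup>2) = a\<^sup>2 * tail_energy g m"
    by (simp add: power_mult_distrib sum_distrib_left[symmetric] tail_vec_norm)
  finally show ?thesis by (simp flip: exp_add)
qed

text \<open>A measurable majorant of the maximum: \<open>le_sqrt_plus_exp\<close> with
  \<open>s = sqrt (real D)\<close>, the maximum over starting points and both signs being replaced
  by the sum of all \<open>2 * D\<close> exponentials, each of mean 1.\<close>

definition noise_max :: "real \<Rightarrow> real vec \<Rightarrow> (nat \<Rightarrow> real) \<Rightarrow> real" where
  "noise_max \<delta> g z = \<delta>\<^sup>2 / 2 * sqrt (real D)
    + \<delta>\<^sup>2 / (2 * sqrt (real D)) * (\<Sum>m<D. tail_exp (2 / \<delta>) g m z + tail_exp (- (2 / \<delta>)) g m z)"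

text \<open>
  The slope \<open>2 / \<delta>\<^sup>2\<close> is the one for which the exponential of the drifted partial sums has mean 1.
\<close>

lemma tail_noise_le_noise_max:
  assumes m: "m < D" and \<delta>: "0 < \<delta>"
  shows "\<bar>\<Sum>i\<in>{m..<D}. (g \<bullet> u i) * ((\<delta> \<cdot>\<^sub>v vec D z) \<bullet> u i)\<bar> - (\<Sum>i\<in>{m..<D}. (g \<bullet> u i)\<^sup>2) \<le> noise_max \<delta> g z"
proof -
  define s where "s = sqrt (real D)"
  have s: "0 < s" using m by (simp add: s_def)
  have bound: "\<sigma> * (\<delta> * (\<Sum>l<D. tail_vec g m l * z l)) - tail_energy g m \<le> noise_max \<delta> g z"
    if "\<sigma> = 1 \<or> \<sigma> = - 1" for \<sigma> :: real
  proof -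
    define W where "W = (\<Sum>l<D. tail_vec g m l * z l)"
    define a where "a = 2 / \<delta>\<^sup>2 * (\<sigma> * (\<delta> * W) - tail_energy g m)"
    have te: "tail_exp (\<sigma> * (2 / \<delta>)) g m z = exp a"
    proof -
      have "(\<Sum>l<D. \<sigma> * (2 / \<delta>) * tail_vec g m l * z l) = \<sigma> * (2 / \<delta>) * W"
        by (simp add: W_def sum_distrib_left mult.assoc)
      moreover have "(\<sigma> * (2 / \<delta>))\<^sup>2 / 2 = 2 / \<delta>\<^sup>2" using that by (auto simp: power2_eq_square)
      moreover have "a = \<sigma> * (2 / \<delta>) * W + - (2 / \<delta>\<^sup>2) * tail_energy g m"
        using \<delta> by (simp add: a_def power2_eq_square field_simps)
      ultimately show ?thesis unfolding tail_exp_def by (simp only: exp_add)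
    qed
    have pos: "0 \<le> tail_exp b g k z" for b k by (simp add: tail_exp_def)
    have "exp a \<le> tail_exp (2 / \<delta>) g m z + tail_exp (- (2 / \<delta>)) g m z"
      using that te pos[of "2 / \<delta>" m] pos[of "- (2 / \<delta>)" m] by auto
    also have "\<dots> \<le> (\<Sum>m<D. tail_exp (2 / \<delta>) g m z + tail_exp (- (2 / \<delta>)) g m z)"
      using m pos by (intro member_le_sum[of m "{..<D}" "\<lambda>m. tail_exp (2 / \<delta>) g m z + tail_exp (- (2 / \<delta>)) g m z"]) auto
    finally have "exp a / s \<le> (\<Sum>m<D. tail_exp (2 / \<delta>) g m z + tail_exp (- (2 / \<delta>)) g m z) / s"
      using s by (simp add: divide_right_mono)
    then have "a \<le> s + (\<Sum>m<D. tail_exp (2 / \<delta>) g m z + tail_exp (- (2 / \<delta>)) g m z) / s"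
      using le_sqrt_plus_exp[OF s, of a] by linarith
    then have "\<delta>\<^sup>2 / 2 * a \<le> \<delta>\<^sup>2 / 2 * (s + (\<Sum>m<D. tail_exp (2 / \<delta>) g m z + tail_exp (- (2 / \<delta>)) g m z) / s)"
      by (rule mult_left_mono) simp
    also have "\<dots> = noise_max \<delta> g z"
      unfolding noise_max_def s_def[symmetric] using s by (simp add: field_simps)
    also have "\<delta>\<^sup>2 / 2 * a = \<sigma> * (\<delta> * W) - tail_energy g m"
      using \<delta> by (simp add: a_def)
    finally show ?thesis by (simp add: W_def)
  qed
  show ?thesis
    unfolding tail_noise tail_energy_def[symmetric] using bound[of 1] bound[of "- 1"] by linarith
qed

lemma noise_max_nonneg: "0 \<le> noise_max \<delta> g z"
  unfolding noise_max_def by (intro add_nonneg_nonneg mult_nonneg_nonneg sum_nonneg) (auto simp: tail_exp_def)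

lemma noise_max_measurable[measurable]: "noise_max \<delta> g \<in> borel_measurable (std_gaussian D)"
  unfolding noise_max_def tail_exp_def by measurable

lemma noise_max_mean:
  assumes "0 < D"
  shows "(\<integral>\<^sup>+z. ennreal (noise_max \<delta> g z) \<partial>std_gaussian D) = ennreal (3 / 2 * (\<delta>\<^sup>2 * sqrt (real D)))"
proof -
  define s where "s = sqrt (real D)"
  have s: "0 < s" "s * s = real D" using assms by (simp_all add: s_def)
  have [measurable]: "tail_exp a g m \<in> borel_measurable (std_gaussian D)" for a m
    unfolding tail_exp_def by measurable
  have pos: "0 \<le> tail_exp b g k z" for b k z by (simp add: tail_exp_def)
  have "(\<integral>\<^sup>+z. ennreal (\<Sum>m<D. tail_exp (2 / \<delta>) g m z + tail_exp (- (2 / \<delta>)) g m z) \<partial>std_gaussian D) =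
      (\<Sum>m<D. (\<integral>\<^sup>+z. ennreal (tail_exp (2 / \<delta>) g m z) + ennreal (tail_exp (- (2 / \<delta>)) g m z) \<partial>std_gaussian D))"
    using pos by (subst nn_integral_sum[symmetric]) (auto simp: sum_ennreal ennreal_plus[symmetric] simp del: ennreal_plus)
  also have "\<dots> = (\<Sum>m<D. 2)"
    by (intro sum.cong refl) (simp add: nn_integral_add tail_exp_mean)
  also have "\<dots> = ennreal (2 * real D)"
    by (simp add: ennreal_of_nat_eq_real_of_nat ennreal_mult mult.commute)
  finally have sum: "(\<integral>\<^sup>+z. ennreal (\<Sum>m<D. tail_exp (2 / \<delta>) g m z + tail_exp (- (2 / \<delta>)) g m z)
      \<partial>std_gaussian D) = ennreal (2 * real D)" .
  have "(\<integral>\<^sup>+z. ennreal (noise_max \<delta> g z) \<partial>std_gaussian D) =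
      (\<integral>\<^sup>+z. ennreal (\<delta>\<^sup>2 / 2 * s) + ennreal (\<delta>\<^sup>2 / (2 * s)) *
        ennreal (\<Sum>m<D. tail_exp (2 / \<delta>) g m z + tail_exp (- (2 / \<delta>)) g m z) \<partial>std_gaussian D)"
    unfolding noise_max_def s_def[symmetric] using s(1) pos
    by (intro nn_integral_cong) (simp add: ennreal_plus[symmetric] ennreal_mult[symmetric] sum_nonneg del: ennreal_plus)
  also have "\<dots> = ennreal (\<delta>\<^sup>2 / 2 * s) + ennreal (\<delta>\<^sup>2 / (2 * s)) * ennreal (2 * real D)"
    using std_gaussian.emeasure_space_1[of D]
    by (simp add: nn_integral_add nn_integral_cmult sum[unfolded sum.distrib])
  also have "\<dots> = ennreal (\<delta>\<^sup>2 / 2 * s + \<delta>\<^sup>2 / (2 * s) * (2 * real D))"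
    using s(1) by (simp add: ennreal_plus[symmetric] ennreal_mult[symmetric] del: ennreal_plus)
  also have "\<delta>\<^sup>2 / 2 * s + \<delta>\<^sup>2 / (2 * s) * (2 * real D) = 3 / 2 * (\<delta>\<^sup>2 * s)"
    using s(1) by (simp add: s(2)[symmetric] field_simps)
  finally show ?thesis by (simp add: s_def)
qed

section \<open>Fluctuation of the squared noise norm\<close>

definition norm_dev :: "real \<Rightarrow> (nat \<Rightarrow> real) \<Rightarrow> real" where
  "norm_dev \<delta> z = \<delta>\<^sup>2 / 2 * sqrt (real D) + \<delta>\<^sup>2 / (2 * sqrt (real D)) * (\<Sum>l<D. (z l)\<^sup>2 - 1)\<^sup>2"

lemma norm_dev_nonneg: "0 \<le> norm_dev \<delta> z"
  by (simp add: norm_dev_def)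

lemma norm_dev_measurable[measurable]: "norm_dev \<delta> \<in> borel_measurable (std_gaussian D)"
  unfolding norm_dev_def by measurable

text \<open>The bound \<open>\<bar>q\<bar> \<le> s / 2 + q\<^sup>2 / (2 * s)\<close> linearises the
  absolute value; as \<open>q\<close> has variance \<open>2 * D\<close>, the choice
  \<open>s = sqrt (real D)\<close> gives a mean of that order.\<close>

lemma noise_norm_le_norm_dev:
  assumes "0 < D"
  shows "\<bar>\<delta>\<^sup>2 * real D - (\<delta> \<cdot>\<^sub>v vec D z) \<bullet> (\<delta> \<cdot>\<^sub>v vec D z)\<bar> \<le> norm_dev \<delta> z"
proof -
  define s where "s = sqrt (real D)"
  define q where "q = (\<Sum>l<D. (z l)\<^sup>2 - 1)"
  have s: "0 < s" using assms by (simp add: s_def)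
  have "(\<delta> \<cdot>\<^sub>v vec D z) \<bullet> (\<delta> \<cdot>\<^sub>v vec D z) = \<delta>\<^sup>2 * (\<Sum>l<D. (z l)\<^sup>2)"
    by (simp add: scalar_prod_def atLeast0LessThan sum_distrib_left power2_eq_square mult_ac)
  then have "\<bar>\<delta>\<^sup>2 * real D - (\<delta> \<cdot>\<^sub>v vec D z) \<bullet> (\<delta> \<cdot>\<^sub>v vec D z)\<bar> = \<delta>\<^sup>2 * \<bar>q\<bar>"
    by (simp add: q_def sum_subtractf abs_mult abs_minus_commute flip: right_diff_distrib)
  also have "\<bar>q\<bar> \<le> s / 2 + q\<^sup>2 / (2 * s)"
  proof -
    have "2 * s * \<bar>q\<bar> \<le> s\<^sup>2 + q\<^sup>2" using sum_squares_bound[of s "\<bar>q\<bar>"] by simp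
    then show ?thesis using s by (simp add: field_simps power2_eq_square)
  qed
  then have "\<delta>\<^sup>2 * \<bar>q\<bar> \<le> \<delta>\<^sup>2 * (s / 2 + q\<^sup>2 / (2 * s))" by (rule mult_left_mono) simp
  also have "\<dots> = norm_dev \<delta> z"
    by (simp add: norm_dev_def s_def q_def distrib_left)
  finally show ?thesis .
qed

lemma norm_dev_mean:
  assumes "0 < D"
  shows "(\<integral>\<^sup>+z. ennreal (norm_dev \<delta> z) \<partial>std_gaussian D) = ennreal (3 / 2 * (\<delta>\<^sup>2 * sqrt (real D)))"
proof -
  define s where "s = sqrt (real D)"
  have s: "0 < s" "s * s = real D" using assms by (simp_all add: s_def)
  have "(\<integral>\<^sup>+z. ennreal (norm_dev \<delta> z) \<partial>std_gaussian D) =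
      (\<integral>\<^sup>+z. ennreal (\<delta>\<^sup>2 / 2 * s) + ennreal (\<delta>\<^sup>2 / (2 * s)) * ennreal ((\<Sum>l<D. (z l)\<^sup>2 - 1)\<^sup>2) \<partial>std_gaussian D)"
    unfolding norm_dev_def s_def[symmetric] using s(1)
    by (intro nn_integral_cong) (simp add: ennreal_plus[symmetric] ennreal_mult[symmetric] del: ennreal_plus)
  also have "\<dots> = ennreal (\<delta>\<^sup>2 / 2 * s) + ennreal (\<delta>\<^sup>2 / (2 * s)) * ennreal (2 * real D)"
    using std_gaussian.emeasure_space_1[of D] gaussian_norm_variance[where b = 0 and D = D]
    by (simp add: nn_integral_add nn_integral_cmult)
  also have "\<dots> = ennreal (\<delta>\<^sup>2 / 2 * s + \<delta>\<^sup>2 / (2 * s) * (2 * real D))"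
    using s(1) by (simp add: ennreal_plus[symmetric] ennreal_mult[symmetric] del: ennreal_plus)
  also have "\<delta>\<^sup>2 / 2 * s + \<delta>\<^sup>2 / (2 * s) * (2 * real D) = 3 / 2 * (\<delta>\<^sup>2 * s)"
    using s(1) by (simp add: s(2)[symmetric] field_simps)
  finally show ?thesis by (simp add: s_def)
qed

text \<open>Each coordinate is an affine function of \<open>z\<close> with nonzero linear part,
  because \<open>u i\<close> is a unit vector. It vanishes only on a null hyperplane.\<close>

lemma observation_generic:
  assumes g: "g \<in> carrier_vec D" and \<delta>: "0 < \<delta>"
  shows "AE z in std_gaussian D. \<forall>i<D. (g + \<delta> \<cdot>\<^sub>v vec D z) \<bullet> u i \<noteq> 0"
proof -
  have "AE z in std_gaussian D. (g + \<delta> \<cdot>\<^sub>v vec D z) \<bullet> u i \<noteq> 0" if i: "i < D" for i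
  proof -
    have "\<exists>j<D. u i $ j \<noteq> 0"
    proof (rule ccontr)
      assume "\<not> ?thesis"
      then have "u i \<bullet> u i = 0" by (simp add: scalar_prod_def u_dim[OF i])
      then show False using u_orthonormal[OF i i] by simp
    qed
    then obtain j where "j < D" "\<delta> * u i $ j \<noteq> 0" using \<delta> by auto
    then have "AE z in std_gaussian D. g \<bullet> u i + (\<Sum>l<D. \<delta> * u i $ l * z l) \<noteq> 0"
      by (rule gaussian_hyperplane_null)
    moreover have "(g + \<delta> \<cdot>\<^sub>v vec D z) \<bullet> u i = g \<bullet> u i + (\<Sum>l<D. \<delta> * u i $ l * z l)" for z
      using add_scalar_prod_distrib[OF g _ u_carrier[OF i], of "\<delta> \<cdot>\<^sub>v vec D z"] noise_coord[OF i, of \<delta> z]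
      by (simp add: sum_distrib_left mult.assoc)
    ultimately show ?thesis by simp
  qed
  then show ?thesis by (simp add: AE_all_countable all_simps AE_impI)
qed

text \<open>The pathwise bound holds off a null set and is integrated. The part \<open>rest\<close>
  is measurable with explicit mean, which is what \<open>nn_integral_le_cmult_add\<close> asks for;
  the error at the oracle stays inside its integral.\<close>

theorem expected_prediction_error_le:
  fixes f :: "real vec" and \<delta> \<kappa> :: real
  assumes f: "f \<in> carrier_vec P" and D: "0 < D" and \<delta>: "0 < \<delta>" and \<kappa>: "0 < \<kappa>"
  defines "g \<equiv> A *\<^sub>v f" and "\<xi> \<equiv> \<lambda>z. \<delta> \<cdot>\<^sub>v vec D z"
  shows "(\<integral>\<^sup>+z. ennreal ((euclid_norm (A *\<^sub>v
        (cg_estimator D A sv u (g + \<xi> z) (stopping_time D A sv u \<kappa> (g + \<xi> z)) - f)))\<^sup>2) \<partial>std_gaussian D)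
    \<le> ennreal 300 * ((\<integral>\<^sup>+z. ennreal (stoch_err D sv u g (\<xi> z) (balanced_oracle D A sv u g (\<xi> z))) \<partial>std_gaussian D)
        + ennreal (\<delta>\<^sup>2 * sqrt (real D)) + ennreal \<bar>\<kappa> - \<delta>\<^sup>2 * real D\<bar>)"
    (is "?lhs \<le> ennreal 300 * (?S + ?a + ?b)")
proof -
  have g: "g \<in> carrier_vec D" using A_carrier f by (auto simp: g_def)
  define rest where "rest z = 4 * noise_max \<delta> g z + 2 * norm_dev \<delta> z + 2 * \<bar>\<kappa> - \<delta>\<^sup>2 * real D\<bar>" for z
  have comb: "ennreal 4 * ennreal a + ennreal 2 * ennreal b + ennreal 2 * ennreal c = ennreal (4 * a + 2 * b + 2 * c)"
    if "0 \<le> a" "0 \<le> b" "0 \<le> c" for a b c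
    using that by (simp add: ennreal_plus ennreal_mult')
  have [measurable]: "rest \<in> borel_measurable (std_gaussian D)" unfolding rest_def by measurable
  have "?lhs \<le> ennreal 300 * ?S + (\<integral>\<^sup>+z. ennreal (rest z) \<partial>std_gaussian D)"
  proof (rule nn_integral_le_cmult_add)
    show "AE z in std_gaussian D. ennreal ((euclid_norm (A *\<^sub>v
        (cg_estimator D A sv u (g + \<xi> z) (stopping_time D A sv u \<kappa> (g + \<xi> z)) - f)))\<^sup>2)
      \<le> ennreal 300 * ennreal (stoch_err D sv u g (\<xi> z) (balanced_oracle D A sv u g (\<xi> z))) + ennreal (rest z)"
      using observation_generic[OF g \<delta>]
    proof eventually_elim
      case (elim z)
      interpret observed_signal D P A sv u v f "\<xi> z"
        using f elim by unfold_locales (auto simp: \<xi>_def g_def)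
      have "(euclid_norm (A *\<^sub>v (cg_estimator D A sv u (g + \<xi> z) (stopping_time D A sv u \<kappa> (g + \<xi> z)) - f)))\<^sup>2 \<le>
          300 * stoch_err D sv u g (\<xi> z) (balanced_oracle D A sv u g (\<xi> z))
          + (4 * noise_max \<delta> g z + 2 * \<bar>\<kappa> - \<xi> z \<bullet> \<xi> z\<bar>)"
        unfolding g_def by (rule prediction_error_le[OF \<kappa> noise_max_nonneg])
          (unfold \<xi>_def, rule tail_noise_le_noise_max[OF _ \<delta>])
      moreover have "\<bar>\<kappa> - \<xi> z \<bullet> \<xi> z\<bar> \<le> \<bar>\<kappa> - \<delta>\<^sup>2 * real D\<bar> + norm_dev \<delta> z"
        using noise_norm_le_norm_dev[OF D, of \<delta> z] by (simp add: \<xi>_def)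
      moreover have "a \<le> 300 * s + (4 * m + 2 * k) \<Longrightarrow> k \<le> k' + n \<Longrightarrow> a \<le> 300 * s + (4 * m + 2 * n + 2 * k')"
        for a s m k k' n :: real by linarith
      ultimately have "(euclid_norm (A *\<^sub>v
          (cg_estimator D A sv u (g + \<xi> z) (stopping_time D A sv u \<kappa> (g + \<xi> z)) - f)))\<^sup>2 \<le>
          300 * stoch_err D sv u g (\<xi> z) (balanced_oracle D A sv u g (\<xi> z)) + rest z"
        unfolding rest_def by blast
      then have "ennreal ((euclid_norm (A *\<^sub>v
          (cg_estimator D A sv u (g + \<xi> z) (stopping_time D A sv u \<kappa> (g + \<xi> z)) - f)))\<^sup>2) \<le>
          ennreal (300 * stoch_err D sv u g (\<xi> z) (balanced_oracle D A sv u g (\<xi> z)) + rest z)"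
        by (rule ennreal_leI)
      also have "\<dots> = ennreal (300 * stoch_err D sv u g (\<xi> z) (balanced_oracle D A sv u g (\<xi> z))) + ennreal (rest z)"
        by (rule ennreal_plus) (simp_all add: stoch_err_def rest_def noise_max_nonneg norm_dev_nonneg)
      also have "ennreal (300 * stoch_err D sv u g (\<xi> z) (balanced_oracle D A sv u g (\<xi> z))) =
          ennreal 300 * ennreal (stoch_err D sv u g (\<xi> z) (balanced_oracle D A sv u g (\<xi> z)))"
        by (rule ennreal_mult') simp
      finally show ?case .
    qed
  qed simp_all
  also have "(\<integral>\<^sup>+z. ennreal (rest z) \<partial>std_gaussian D) =
      (\<integral>\<^sup>+z. ennreal 4 * ennreal (noise_max \<delta> g z) + ennreal 2 * ennreal (norm_dev \<delta> z) + ennreal 2 * ?b \<partial>std_gaussian D)"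
    unfolding rest_def by (intro nn_integral_cong) (simp only: comb noise_max_nonneg norm_dev_nonneg abs_ge_zero)
  also have "\<dots> = ennreal 4 * ennreal (3 / 2 * (\<delta>\<^sup>2 * sqrt (real D)))
      + ennreal 2 * ennreal (3 / 2 * (\<delta>\<^sup>2 * sqrt (real D))) + ennreal 2 * ?b"
    using std_gaussian.emeasure_space_1[of D] noise_max_mean[OF D, of \<delta> g] norm_dev_mean[OF D, of \<delta>]
    by (simp add: nn_integral_add nn_integral_cmult)
  also have "\<dots> = ennreal (4 * (3 / 2 * (\<delta>\<^sup>2 * sqrt (real D))) + 2 * (3 / 2 * (\<delta>\<^sup>2 * sqrt (real D)))
      + 2 * \<bar>\<kappa> - \<delta>\<^sup>2 * real D\<bar>)"
    by (rule comb) simp_all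
  \<comment> \<open>The actual factors are 4 * 3/2 + 2 * 3/2 = 9 and 2; both are enlarged to 300 to
    share one constant with the stochastic error.\<close>
  also have "\<dots> \<le> ennreal (300 * (\<delta>\<^sup>2 * sqrt (real D)) + 300 * \<bar>\<kappa> - \<delta>\<^sup>2 * real D\<bar>)"
    by (intro ennreal_leI add_mono mult_right_mono) (auto simp: mult.assoc[symmetric] intro!: mult_right_mono)
  also have "\<dots> = ennreal 300 * ?a + ennreal 300 * ?b"
    by (subst ennreal_plus) (auto simp: ennreal_mult')
  finally show ?thesis by (simp only: distrib_left add.assoc) (simp add: add_left_mono)
qed

end

theorem theorem6p8:
  shows "\<exists>C::real. 0 < C \<and>
    (\<forall>(D::nat) (P::nat) (A::real mat) (sv::nat \<Rightarrow> real) (u::nat \<Rightarrow> real vec) (v::nat \<Rightarrow> real vec)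
      (f::real vec) (\<delta>::real) (\<kappa>::real).
      3 \<le> D \<longrightarrow> D \<le> P \<longrightarrow>
      A \<in> carrier_mat D P \<longrightarrow> vec_space.rank D A = D \<longrightarrow>
      singular_system D P A sv u v \<longrightarrow>
      f \<in> carrier_vec P \<longrightarrow>
      0 < \<delta> \<longrightarrow> \<delta> < 1 \<longrightarrow> 0 < \<kappa> \<longrightarrow>
      (let g = A *\<^sub>v f;
           \<xi> = (\<lambda>z. \<delta> \<cdot>\<^sub>v vec D z);
           Y = (\<lambda>z. g + \<xi> z);
           \<tau> = (\<lambda>z. stopping_time D A sv u \<kappa> (Y z));
           \<tau>b = (\<lambda>z. balanced_oracle D A sv u g (\<xi> z))
       in (\<integral>\<^sup>+z. ennreal ((euclid_norm (A *\<^sub>v (cg_estimator D A sv u (Y z) (\<tau> z) - f)))\<^sup>2)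
              \<partial>std_gaussian D)
          \<le> ennreal C *
             ((\<integral>\<^sup>+z. ennreal (stoch_err D sv u g (\<xi> z) (\<tau>b z)) \<partial>std_gaussian D)
              + ennreal (\<delta>\<^sup>2 * sqrt (real D))
              + ennreal \<bar>\<kappa> - \<delta>\<^sup>2 * real D\<bar>)))"
  unfolding Let_def
proof (intro exI[of _ 300] conjI allI impI)
  fix D P :: nat and A :: "real mat" and sv :: "nat \<Rightarrow> real" and u v :: "nat \<Rightarrow> real vec"
    and f :: "real vec" and \<delta> \<kappa> :: real
  assume "A \<in> carrier_mat D P" "singular_system D P A sv u v"
  then interpret svd_system D P A sv u v by unfold_locales
  assume "3 \<le> D" "f \<in> carrier_vec P" "0 < \<delta>" "0 < \<kappa>"
  then show "(\<integral>\<^sup>+z. ennreal ((euclid_norm (A *\<^sub>v (cg_estimator D A sv u (A *\<^sub>v f + \<delta> \<cdot>\<^sub>v vec D z)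
        (stopping_time D A sv u \<kappa> (A *\<^sub>v f + \<delta> \<cdot>\<^sub>v vec D z)) - f)))\<^sup>2) \<partial>std_gaussian D)
      \<le> ennreal 300 * ((\<integral>\<^sup>+z. ennreal (stoch_err D sv u (A *\<^sub>v f) (\<delta> \<cdot>\<^sub>v vec D z)
          (balanced_oracle D A sv u (A *\<^sub>v f) (\<delta> \<cdot>\<^sub>v vec D z))) \<partial>std_gaussian D)
        + ennreal (\<delta>\<^sup>2 * sqrt (real D)) + ennreal \<bar>\<kappa> - \<delta>\<^sup>2 * real D\<bar>)"
    by (intro expected_prediction_error_le) auto
qed simp

end
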